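(* Let $R$ be a commutative ring with $1$, let $m\ge 0$ and $n\ge 1$ be integers, and let $E^m$ be the Grassmann algebra of rank $m$ over $R$. Then the ring $M_nE^m$ of $n\times n$ matrices over $E^m$ satisfies the Capelli identity of $x$-degree $k=n^2+2\lfloor m/2\rfloor+1$.
   Context: The Grassmann algebra of rank $m$ over $R$ is the $R$-algebra $E^m=R\langle v_1,\dots,v_m\rangle/(v_k^2,\ v_iv_j+v_jv_i\mid 1\le k\le m,\ 1\le i<j\le m)$. The Capelli polynomial $d_k$ is the polynomial in noncommuting variables $$d_k(x_1,\dots,x_k;y_0,\dots,y_k)=\sum_{\pi\in\mathfrak S_k}(-1)^\pi\, y_0x_{\pi(1)}y_1x_{\pi(2)}\cdots y_{k-1}x_{\pi(k)}y_k,$$ where $\mathfrak S_k$ is the symmetric group on $\{1,\dots,k\}$ and $(-1)^\pi$ is the sign of $\pi$. The Capelli identity of $x$-degree $k$ holds in (is satisfied by) a ring $\mathfrak A$ if $d_k(x_1,\dots,x_k;y_0,\dots,y_k)=0$ for all $x_1,\dots,x_k,y_0,\dots,y_k\in\mathfrak A$. *)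

theory Defs
  imports "HOL-Algebra.QuotRing" "HOL-Combinatorics.Permutations" "HOL-Library.FuncSet"
begin

section \<open>Free associative algebras\<close>

text \<open>The elements of \<open>R\<langle>v\<^sub>1,\<dots>,v\<^sub>m\<rangle>\<close> are the finitely supported functions that assign to each
  word over the letters \<open>1,\<dots>,m\<close> its coefficient in \<open>R\<close>; words are lists of letters.\<close>

definition free_algebra :: "('a, 'b) ring_scheme \<Rightarrow> nat \<Rightarrow> (nat list \<Rightarrow> 'a) ring" where
  "free_algebra R m =
    \<lparr>carrier = {f. (\<forall>w. f w \<in> carrier R) \<and> finite {w. f w \<noteq> \<zero>\<^bsub>R\<^esub>} \<and>
                   (\<forall>w. f w \<noteq> \<zero>\<^bsub>R\<^esub> \<longrightarrow> set w \<subseteq> {1..m})},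
     monoid.mult = (\<lambda>f g w. \<Oplus>\<^bsub>R\<^esub>p\<in>{(u, v). u @ v = w}. f (fst p) \<otimes>\<^bsub>R\<^esub> g (snd p)),
     one = (\<lambda>w. if w = [] then \<one>\<^bsub>R\<^esub> else \<zero>\<^bsub>R\<^esub>),
     zero = (\<lambda>w. \<zero>\<^bsub>R\<^esub>),
     add = (\<lambda>f g w. f w \<oplus>\<^bsub>R\<^esub> g w)\<rparr>"

definition free_var :: "('a, 'b) ring_scheme \<Rightarrow> nat \<Rightarrow> nat list \<Rightarrow> 'a" where
  "free_var R i = (\<lambda>w. if w = [i] then \<one>\<^bsub>R\<^esub> else \<zero>\<^bsub>R\<^esub>)"


section \<open>Grassmann algebras\<close>

definition grassmann_relations :: "('a, 'b) ring_scheme \<Rightarrow> nat \<Rightarrow> (nat list \<Rightarrow> 'a) set" where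
  "grassmann_relations R m =
    (let F = free_algebra R m; v = free_var R in
      {v k \<otimes>\<^bsub>F\<^esub> v k | k. 1 \<le> k \<and> k \<le> m} \<union>
      {(v i \<otimes>\<^bsub>F\<^esub> v j) \<oplus>\<^bsub>F\<^esub> (v j \<otimes>\<^bsub>F\<^esub> v i) | i j. 1 \<le> i \<and> i < j \<and> j \<le> m})"

definition grassmann_algebra :: "('a, 'b) ring_scheme \<Rightarrow> nat \<Rightarrow> (nat list \<Rightarrow> 'a) set ring" where
  "grassmann_algebra R m =
    free_algebra R m Quot (Idl\<^bsub>free_algebra R m\<^esub> (grassmann_relations R m))"


section \<open>Matrix rings\<close>

definition matrix_ring :: "nat \<Rightarrow> ('a, 'b) ring_scheme \<Rightarrow> (nat \<times> nat \<Rightarrow> 'a) ring" where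
  "matrix_ring n A =
    \<lparr>carrier = ({1..n} \<times> {1..n}) \<rightarrow>\<^sub>E carrier A,
     monoid.mult = (\<lambda>M N. \<lambda>p\<in>{1..n} \<times> {1..n}. \<Oplus>\<^bsub>A\<^esub>l\<in>{1..n}. M (fst p, l) \<otimes>\<^bsub>A\<^esub> N (l, snd p)),
     one = (\<lambda>p\<in>{1..n} \<times> {1..n}. if fst p = snd p then \<one>\<^bsub>A\<^esub> else \<zero>\<^bsub>A\<^esub>),
     zero = (\<lambda>p\<in>{1..n} \<times> {1..n}. \<zero>\<^bsub>A\<^esub>),
     add = (\<lambda>M N. \<lambda>p\<in>{1..n} \<times> {1..n}. M p \<oplus>\<^bsub>A\<^esub> N p)\<rparr>"


section \<open>Capelli polynomials and identities\<close>

text \<open>\<open>capelli_monomial A \<pi> x y k\<close> is \<open>y\<^sub>0 x\<^bsub>\<pi>(1)\<^esub> y\<^sub>1 x\<^bsub>\<pi>(2)\<^esub> \<dots> y\<^bsub>k-1\<^esub> x\<^bsub>\<pi>(k)\<^esub> y\<^sub>k\<close>.\<close>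

primrec capelli_monomial ::
    "('a, 'b) ring_scheme \<Rightarrow> (nat \<Rightarrow> nat) \<Rightarrow> (nat \<Rightarrow> 'a) \<Rightarrow> (nat \<Rightarrow> 'a) \<Rightarrow> nat \<Rightarrow> 'a" where
  "capelli_monomial A \<pi> x y 0 = y 0"
| "capelli_monomial A \<pi> x y (Suc j) =
     capelli_monomial A \<pi> x y j \<otimes>\<^bsub>A\<^esub> x (\<pi> (Suc j)) \<otimes>\<^bsub>A\<^esub> y (Suc j)"

text \<open>The value in \<open>A\<close> of the Capelli polynomial \<open>d\<^sub>k\<close> at \<open>x\<^sub>1,\<dots>,x\<^sub>k\<close> and \<open>y\<^sub>0,\<dots>,y\<^sub>k\<close>.\<close>

definition capelli ::
    "('a, 'b) ring_scheme \<Rightarrow> nat \<Rightarrow> (nat \<Rightarrow> 'a) \<Rightarrow> (nat \<Rightarrow> 'a) \<Rightarrow> 'a" where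
  "capelli A k x y =
    (\<Oplus>\<^bsub>A\<^esub>\<pi>\<in>{\<pi>. \<pi> permutes {1..k}}. [sign \<pi>] \<cdot>\<^bsub>A\<^esub> capelli_monomial A \<pi> x y k)"

definition satisfies_capelli :: "('a, 'b) ring_scheme \<Rightarrow> nat \<Rightarrow> bool" where
  "satisfies_capelli A k \<longleftrightarrow>
    (\<forall>x y. x \<in> {1..k} \<rightarrow> carrier A \<longrightarrow> y \<in> {0..k} \<rightarrow> carrier A \<longrightarrow> capelli A k x y = \<zero>\<^bsub>A\<^esub>)"


section \<open>The constructions yield rings\<close>

lemma (in abelian_monoid) finsum_Sigma:
  assumes "finite S" "\<And>a. a \<in> S \<Longrightarrow> finite (T a)"
    and "\<And>a b. a \<in> S \<Longrightarrow> b \<in> T a \<Longrightarrow> f a b \<in> carrier G"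
  shows "(\<Oplus>a\<in>S. \<Oplus>b\<in>T a. f a b) = (\<Oplus>p\<in>Sigma S T. f (fst p) (snd p))"
  using assms
proof (induction S rule: finite_induct)
  case (insert s S)
  have eq: "Sigma (insert s S) T = Pair s ` T s \<union> Sigma S T"
    by auto
  have "(\<Oplus>p\<in>Sigma (insert s S) T. f (fst p) (snd p)) =
      (\<Oplus>p\<in>Pair s ` T s. f (fst p) (snd p)) \<oplus> (\<Oplus>p\<in>Sigma S T. f (fst p) (snd p))"
    unfolding eq by (rule finsum_Un_disjoint) (use insert in auto)
  moreover have "(\<Oplus>p\<in>Pair s ` T s. f (fst p) (snd p)) = (\<Oplus>b\<in>T s. f s b)"
    by (subst finsum_reindex) (use insert in \<open>auto simp: inj_on_def\<close>)
  moreover have "(\<Oplus>a\<in>insert s S. \<Oplus>b\<in>T a. f a b) = (\<Oplus>b\<in>T s. f s b) \<oplus> (\<Oplus>a\<in>S. \<Oplus>b\<in>T a. f a b)"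
    using insert by (intro finsum_insert) (auto intro!: finsum_closed)
  ultimately show ?case
    using insert by simp
qed simp

lemma (in abelian_monoid) finsum_bij:
  assumes "bij_betw h S T" "\<And>b. b \<in> T \<Longrightarrow> f b \<in> carrier G"
  shows "(\<Oplus>b\<in>T. f b) = (\<Oplus>a\<in>S. f (h a))"
  using assms finsum_reindex[of f h S] by (auto simp: bij_betw_def Pi_def)

lemma finite_append_splits: "finite {(u, v). u @ v = (w :: 'c list)}"
proof -
  have "{(u, v). u @ v = w} \<subseteq> (\<lambda>i. (take i w, drop i w)) ` {..length w}"
  proof
    fix p assume "p \<in> {(u, v). u @ v = w}"
    then have "p = (take (length (fst p)) w, drop (length (fst p)) w)" "length (fst p) \<le> length w"
      by auto
    then show "p \<in> (\<lambda>i. (take i w, drop i w)) ` {..length w}"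
      by blast
  qed
  then show ?thesis
    using finite_subset by blast
qed

context ring
begin

lemma free_algebra_mult_closed:
  assumes "f \<in> carrier (free_algebra R m)" "g \<in> carrier (free_algebra R m)"
  shows "f \<otimes>\<^bsub>free_algebra R m\<^esub> g \<in> carrier (free_algebra R m)"
proof -
  let ?h = "f \<otimes>\<^bsub>free_algebra R m\<^esub> g"
  have f: "f w \<in> carrier R" and g: "g w \<in> carrier R" for w
    using assms by (auto simp: free_algebra_def)
  have supp: "\<exists>u v. w = u @ v \<and> f u \<noteq> \<zero> \<and> g v \<noteq> \<zero>" if "?h w \<noteq> \<zero>" for w
  proof (rule ccontr)
    assume *: "\<not> ?thesis"
    have "f (fst p) \<otimes> g (snd p) = \<zero>" if "p \<in> {(u, v). u @ v = w}" for p
    proof (cases "f (fst p) = \<zero>")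
      case False
      then have "g (snd p) = \<zero>"
        using * that by fastforce
      then show ?thesis
        using f by simp
    qed (use g in simp)
    then have "(\<Oplus>p\<in>{(u, v). u @ v = w}. f (fst p) \<otimes> g (snd p)) = \<zero>"
      by (rule add.finprod_one_eqI)
    then have "?h w = \<zero>"
      by (simp add: free_algebra_def)
    then show False
      using that by simp
  qed
  have "{w. ?h w \<noteq> \<zero>} \<subseteq> (\<lambda>(u, v). u @ v) ` ({w. f w \<noteq> \<zero>} \<times> {w. g w \<noteq> \<zero>})"
  proof
    fix w assume "w \<in> {w. ?h w \<noteq> \<zero>}"
    then obtain u v where "w = u @ v" "f u \<noteq> \<zero>" "g v \<noteq> \<zero>"
      using supp by blast
    then show "w \<in> (\<lambda>(u, v). u @ v) ` ({w. f w \<noteq> \<zero>} \<times> {w. g w \<noteq> \<zero>})"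
      by (intro image_eqI[of _ _ "(u, v)"]) auto
  qed
  then have "finite {w. ?h w \<noteq> \<zero>}"
    by (rule finite_subset) (use assms in \<open>auto simp: free_algebra_def\<close>)
  moreover have "set w \<subseteq> {1..m}" if "?h w \<noteq> \<zero>" for w
  proof -
    obtain u v where "w = u @ v" "f u \<noteq> \<zero>" "g v \<noteq> \<zero>"
      using supp[OF \<open>?h w \<noteq> \<zero>\<close>] by blast
    moreover from this have "set u \<subseteq> {1..m}" "set v \<subseteq> {1..m}"
      using assms by (simp_all add: free_algebra_def)
    ultimately show ?thesis
      by simp
  qed
  moreover have "?h w \<in> carrier R" for w
    using f g by (simp add: free_algebra_def finsum_closed Pi_def)
  ultimately show ?thesis
    unfolding free_algebra_def by simp
qed

lemma free_algebra_ring: "ring (free_algebra R m)"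
proof (rule ringI)
  let ?F = "free_algebra R m"
  show "abelian_group ?F"
  proof (rule abelian_groupI)
    fix f g assume fg: "f \<in> carrier ?F" "g \<in> carrier ?F"
    have supp: "f w \<noteq> \<zero> \<or> g w \<noteq> \<zero>" if "f w \<oplus> g w \<noteq> \<zero>" for w
      using that by auto
    have "finite ({w. f w \<noteq> \<zero>} \<union> {w. g w \<noteq> \<zero>})"
      using fg by (simp add: free_algebra_def)
    then have "finite {w. f w \<oplus> g w \<noteq> \<zero>}"
      by (rule rev_finite_subset) (use supp in blast)
    moreover have "set w \<subseteq> {1..m}" if "f w \<oplus> g w \<noteq> \<zero>" for w
      using supp[OF that] fg unfolding free_algebra_def by fastforce
    ultimately show "f \<oplus>\<^bsub>?F\<^esub> g \<in> carrier ?F"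
      using fg by (simp add: free_algebra_def)
  next
    fix f assume f: "f \<in> carrier ?F"
    then have *: "f w \<in> carrier R" for w
      by (auto simp: free_algebra_def)
    have "\<ominus> f w = \<zero> \<longleftrightarrow> f w = \<zero>" for w
      using * add.inv_eq_1_iff by blast
    then have "(\<lambda>w. \<ominus> f w) \<in> carrier ?F"
      using f by (auto simp: free_algebra_def)
    moreover have "(\<lambda>w. \<ominus> f w) \<oplus>\<^bsub>?F\<^esub> f = \<zero>\<^bsub>?F\<^esub>"
      using * by (auto simp: free_algebra_def l_neg)
    ultimately show "\<exists>g\<in>carrier ?F. g \<oplus>\<^bsub>?F\<^esub> f = \<zero>\<^bsub>?F\<^esub>"
      by blast
  qed (auto simp: free_algebra_def a_ac)
next
  let ?F = "free_algebra R m"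
  show "monoid ?F"
  proof (rule monoidI)
    fix f g h assume "f \<in> carrier ?F" "g \<in> carrier ?F" "h \<in> carrier ?F"
    then have c: "f w \<in> carrier R" "g w \<in> carrier R" "h w \<in> carrier R" for w
      by (auto simp: free_algebra_def)
    let ?D = "\<lambda>w. {(u, v). u @ v = (w :: nat list)}"
    show "f \<otimes>\<^bsub>?F\<^esub> g \<otimes>\<^bsub>?F\<^esub> h = f \<otimes>\<^bsub>?F\<^esub> (g \<otimes>\<^bsub>?F\<^esub> h)"
    proof
      fix w
      let ?L = "Sigma (?D w) (\<lambda>p. ?D (fst p))" and ?R = "Sigma (?D w) (\<lambda>p. ?D (snd p))"
      have "(f \<otimes>\<^bsub>?F\<^esub> g \<otimes>\<^bsub>?F\<^esub> h) w =
          (\<Oplus>p\<in>?D w. \<Oplus>q\<in>?D (fst p). f (fst q) \<otimes> g (snd q) \<otimes> h (snd p))"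
        unfolding free_algebra_def
        by (auto intro!: finsum_cong' finsum_closed finsum_ldistr finite_append_splits simp: c)
      also have "\<dots> = (\<Oplus>r\<in>?L. f (fst (snd r)) \<otimes> g (snd (snd r)) \<otimes> h (snd (fst r)))"
        by (rule finsum_Sigma) (auto intro!: finite_append_splits simp: c)
      also have "\<dots> = (\<Oplus>r\<in>?R. f (fst (fst r)) \<otimes> g (fst (snd r)) \<otimes> h (snd (snd r)))"
      proof -
        have "bij_betw (\<lambda>((u, v), (s, t)). ((u @ s, t), (u, s))) ?R ?L"
          by (rule bij_betw_byWitness[where f' = "\<lambda>((u, v), (s, t)). ((s, t @ v), (t, v))"]) auto
        then show ?thesis
          by (subst finsum_bij) (auto simp: c intro!: finsum_cong')
      qed
      also have "\<dots> = (\<Oplus>p\<in>?D w. \<Oplus>q\<in>?D (snd p). f (fst p) \<otimes> g (fst q) \<otimes> h (snd q))"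
        by (rule finsum_Sigma[symmetric]) (auto intro!: finite_append_splits simp: c)
      also have "\<dots> = (f \<otimes>\<^bsub>?F\<^esub> (g \<otimes>\<^bsub>?F\<^esub> h)) w"
        unfolding free_algebra_def
        by (auto intro!: finsum_cong' finsum_closed simp: c m_assoc finsum_rdistr finite_append_splits)
      finally show "(f \<otimes>\<^bsub>?F\<^esub> g \<otimes>\<^bsub>?F\<^esub> h) w = (f \<otimes>\<^bsub>?F\<^esub> (g \<otimes>\<^bsub>?F\<^esub> h)) w" .
    qed
  next
    fix f assume "f \<in> carrier ?F"
    then have c: "f w \<in> carrier R" for w
      by (auto simp: free_algebra_def)
    show "\<one>\<^bsub>?F\<^esub> \<otimes>\<^bsub>?F\<^esub> f = f"
    proof
      fix w
      have "(\<one>\<^bsub>?F\<^esub> \<otimes>\<^bsub>?F\<^esub> f) w = (\<Oplus>p\<in>{(u, v). u @ v = w}. if ([], w) = p then f w else \<zero>)"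
        unfolding free_algebra_def by (auto intro!: finsum_cong' simp: c)
      then show "(\<one>\<^bsub>?F\<^esub> \<otimes>\<^bsub>?F\<^esub> f) w = f w"
        using finsum_singleton[of "([], w)" "{(u, v). u @ v = w}" "\<lambda>_. f w"]
        by (simp add: c finite_append_splits)
    qed
    show "f \<otimes>\<^bsub>?F\<^esub> \<one>\<^bsub>?F\<^esub> = f"
    proof
      fix w
      have "(f \<otimes>\<^bsub>?F\<^esub> \<one>\<^bsub>?F\<^esub>) w = (\<Oplus>p\<in>{(u, v). u @ v = w}. if (w, []) = p then f w else \<zero>)"
        unfolding free_algebra_def by (auto intro!: finsum_cong' simp: c)
      then show "(f \<otimes>\<^bsub>?F\<^esub> \<one>\<^bsub>?F\<^esub>) w = f w"
        using finsum_singleton[of "(w, [])" "{(u, v). u @ v = w}" "\<lambda>_. f w"]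
        by (simp add: c finite_append_splits)
    qed
  next
    show "\<one>\<^bsub>?F\<^esub> \<in> carrier ?F"
      by (auto simp: free_algebra_def)
  qed (rule free_algebra_mult_closed)
next
  let ?F = "free_algebra R m"
  fix f g h assume "f \<in> carrier ?F" "g \<in> carrier ?F" "h \<in> carrier ?F"
  then have c: "f w \<in> carrier R" "g w \<in> carrier R" "h w \<in> carrier R" for w
    by (auto simp: free_algebra_def)
  show "(f \<oplus>\<^bsub>?F\<^esub> g) \<otimes>\<^bsub>?F\<^esub> h = (f \<otimes>\<^bsub>?F\<^esub> h) \<oplus>\<^bsub>?F\<^esub> (g \<otimes>\<^bsub>?F\<^esub> h)"
    by (rule ext) (simp add: free_algebra_def c l_distr finsum_addf Pi_def)
  show "h \<otimes>\<^bsub>?F\<^esub> (f \<oplus>\<^bsub>?F\<^esub> g) = (h \<otimes>\<^bsub>?F\<^esub> f) \<oplus>\<^bsub>?F\<^esub> (h \<otimes>\<^bsub>?F\<^esub> g)"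
    by (rule ext) (simp add: free_algebra_def c r_distr finsum_addf Pi_def)
qed

lemma free_var_closed: "1 \<le> i \<Longrightarrow> i \<le> m \<Longrightarrow> free_var R i \<in> carrier (free_algebra R m)"
  by (auto simp: free_var_def free_algebra_def)

lemma grassmann_relations_closed: "grassmann_relations R m \<subseteq> carrier (free_algebra R m)"
proof -
  interpret F: ring "free_algebra R m"
    by (rule free_algebra_ring)
  show ?thesis
    by (auto simp: grassmann_relations_def Let_def intro!: F.m_closed F.a_closed free_var_closed)
qed

lemma grassmann_algebra_ring: "ring (grassmann_algebra R m)"
  unfolding grassmann_algebra_def
  by (intro ideal.quotient_is_ring ring.genideal_ideal free_algebra_ring grassmann_relations_closed)

lemma matrix_ring_ring: "ring (matrix_ring n R)"
proof (rule ringI)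
  let ?M = "matrix_ring n R" and ?I = "{1..n} \<times> {1..n}"
  have ext: "A = B" if "A \<in> carrier ?M" "B \<in> carrier ?M"
    "\<And>i j. i \<in> {1..n} \<Longrightarrow> j \<in> {1..n} \<Longrightarrow> A (i, j) = B (i, j)" for A B
    by (rule PiE_ext[of _ ?I "\<lambda>_. carrier R"]) (use that in \<open>auto simp: matrix_ring_def\<close>)
  have entry: "A (i, j) \<in> carrier R"
    if "A \<in> carrier ?M" "i \<in> {1..n}" "j \<in> {1..n}" for A i j
    using that by (auto simp: matrix_ring_def)
  have mult: "(A \<otimes>\<^bsub>?M\<^esub> B) (i, j) = (\<Oplus>l\<in>{1..n}. A (i, l) \<otimes> B (l, j))"
    if "i \<in> {1..n}" "j \<in> {1..n}" for A B i j
    using that by (simp add: matrix_ring_def)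
  have add: "(A \<oplus>\<^bsub>?M\<^esub> B) (i, j) = A (i, j) \<oplus> B (i, j)"
    if "i \<in> {1..n}" "j \<in> {1..n}" for A B i j
    using that by (simp add: matrix_ring_def)
  have one: "\<one>\<^bsub>?M\<^esub> (i, j) = (if i = j then \<one> else \<zero>)"
    if "i \<in> {1..n}" "j \<in> {1..n}" for i j
    using that by (simp add: matrix_ring_def)
  have mult_closed: "A \<otimes>\<^bsub>?M\<^esub> B \<in> carrier ?M" if "A \<in> carrier ?M" "B \<in> carrier ?M" for A B
    using entry[OF that(1)] entry[OF that(2)] by (auto simp: matrix_ring_def intro!: finsum_closed)
  have add_closed: "A \<oplus>\<^bsub>?M\<^esub> B \<in> carrier ?M" if "A \<in> carrier ?M" "B \<in> carrier ?M" for A B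
    using entry[OF that(1)] entry[OF that(2)] by (auto simp: matrix_ring_def)
  have one_closed: "\<one>\<^bsub>?M\<^esub> \<in> carrier ?M"
    by (auto simp: matrix_ring_def)
  show "abelian_group ?M"
  proof (rule abelian_groupI)
    show zero_closed: "\<zero>\<^bsub>?M\<^esub> \<in> carrier ?M"
      by (auto simp: matrix_ring_def)
    fix A assume A: "A \<in> carrier ?M"
    show "\<zero>\<^bsub>?M\<^esub> \<oplus>\<^bsub>?M\<^esub> A = A"
      by (rule ext) (use A zero_closed add_closed entry[OF A] in \<open>auto simp: matrix_ring_def\<close>)
    let ?B = "\<lambda>p\<in>?I. \<ominus> A p"
    have B: "?B \<in> carrier ?M"
      using entry[OF A] by (auto simp: matrix_ring_def)
    moreover have "?B \<oplus>\<^bsub>?M\<^esub> A = \<zero>\<^bsub>?M\<^esub>"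
      by (rule ext[OF add_closed[OF B A] zero_closed])
        (use entry[OF A] in \<open>auto simp: matrix_ring_def l_neg\<close>)
    ultimately show "\<exists>B\<in>carrier ?M. B \<oplus>\<^bsub>?M\<^esub> A = \<zero>\<^bsub>?M\<^esub>"
      by blast
  next
    fix A B C assume *: "A \<in> carrier ?M" "B \<in> carrier ?M" "C \<in> carrier ?M"
    show "A \<oplus>\<^bsub>?M\<^esub> B \<oplus>\<^bsub>?M\<^esub> C = A \<oplus>\<^bsub>?M\<^esub> (B \<oplus>\<^bsub>?M\<^esub> C)"
      by (rule ext) (use * in \<open>simp_all add: add_closed add entry a_assoc\<close>)
  next
    fix A B assume *: "A \<in> carrier ?M" "B \<in> carrier ?M"
    show "A \<oplus>\<^bsub>?M\<^esub> B = B \<oplus>\<^bsub>?M\<^esub> A"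
      by (rule ext) (use * in \<open>simp_all add: add_closed add entry a_comm\<close>)
  qed (rule add_closed)
  show "monoid ?M"
  proof (rule monoidI)
    fix A B C assume *: "A \<in> carrier ?M" "B \<in> carrier ?M" "C \<in> carrier ?M"
    show "A \<otimes>\<^bsub>?M\<^esub> B \<otimes>\<^bsub>?M\<^esub> C = A \<otimes>\<^bsub>?M\<^esub> (B \<otimes>\<^bsub>?M\<^esub> C)"
    proof (rule ext)
      fix i j assume ij: "i \<in> {1..n}" "j \<in> {1..n}"
      note e = entry[OF *(1)] entry[OF *(2)] entry[OF *(3)]
      have "(A \<otimes>\<^bsub>?M\<^esub> B \<otimes>\<^bsub>?M\<^esub> C) (i, j) =
          (\<Oplus>l\<in>{1..n}. (\<Oplus>k\<in>{1..n}. A (i, k) \<otimes> B (k, l)) \<otimes> C (l, j))"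
        using ij e by (auto simp: mult intro!: finsum_cong' finsum_closed)
      also have "\<dots> = (\<Oplus>l\<in>{1..n}. \<Oplus>k\<in>{1..n}. A (i, k) \<otimes> B (k, l) \<otimes> C (l, j))"
        using ij e by (intro finsum_cong' finsum_ldistr) (auto intro!: finsum_closed)
      also have "\<dots> = (\<Oplus>p\<in>?I. A (i, snd p) \<otimes> B (snd p, fst p) \<otimes> C (fst p, j))"
        using ij e by (intro finsum_Sigma) auto
      also have "\<dots> = (\<Oplus>p\<in>?I. A (i, fst p) \<otimes> B (fst p, snd p) \<otimes> C (snd p, j))"
      proof -
        have "bij_betw prod.swap ?I ?I"
          by (rule bij_betw_byWitness[where f' = prod.swap]) auto
        then show ?thesis
          by (subst finsum_bij[of prod.swap ?I ?I]) (use ij e in auto)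
      qed
      also have "\<dots> = (\<Oplus>k\<in>{1..n}. \<Oplus>l\<in>{1..n}. A (i, k) \<otimes> B (k, l) \<otimes> C (l, j))"
        using ij e by (intro finsum_Sigma[symmetric]) auto
      also have "\<dots> = (\<Oplus>k\<in>{1..n}. A (i, k) \<otimes> (\<Oplus>l\<in>{1..n}. B (k, l) \<otimes> C (l, j)))"
        using ij e by (intro finsum_cong') (auto simp: finsum_rdistr m_assoc intro!: finsum_closed finsum_cong')
      also have "\<dots> = (A \<otimes>\<^bsub>?M\<^esub> (B \<otimes>\<^bsub>?M\<^esub> C)) (i, j)"
        using ij e by (auto simp: mult intro!: finsum_cong' finsum_closed)
      finally show "(A \<otimes>\<^bsub>?M\<^esub> B \<otimes>\<^bsub>?M\<^esub> C) (i, j) = (A \<otimes>\<^bsub>?M\<^esub> (B \<otimes>\<^bsub>?M\<^esub> C)) (i, j)" .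
    qed (use * mult_closed in auto)
  next
    fix A assume A: "A \<in> carrier ?M"
    show "\<one>\<^bsub>?M\<^esub> \<otimes>\<^bsub>?M\<^esub> A = A"
    proof (rule ext)
      fix i j assume ij: "i \<in> {1..n}" "j \<in> {1..n}"
      have "(\<one>\<^bsub>?M\<^esub> \<otimes>\<^bsub>?M\<^esub> A) (i, j) = (\<Oplus>l\<in>{1..n}. if i = l then A (l, j) else \<zero>)"
        using ij entry[OF A] by (auto simp: mult one intro!: finsum_cong')
      also have "\<dots> = A (i, j)"
        by (rule finsum_singleton) (use ij entry[OF A] in auto)
      finally show "(\<one>\<^bsub>?M\<^esub> \<otimes>\<^bsub>?M\<^esub> A) (i, j) = A (i, j)" .
    qed (use A mult_closed one_closed in auto)
    show "A \<otimes>\<^bsub>?M\<^esub> \<one>\<^bsub>?M\<^esub> = A"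
    proof (rule ext)
      fix i j assume ij: "i \<in> {1..n}" "j \<in> {1..n}"
      have "(A \<otimes>\<^bsub>?M\<^esub> \<one>\<^bsub>?M\<^esub>) (i, j) = (\<Oplus>l\<in>{1..n}. if j = l then A (i, l) else \<zero>)"
        using ij entry[OF A] by (auto simp: mult one intro!: finsum_cong')
      also have "\<dots> = A (i, j)"
        by (rule finsum_singleton) (use ij entry[OF A] in auto)
      finally show "(A \<otimes>\<^bsub>?M\<^esub> \<one>\<^bsub>?M\<^esub>) (i, j) = A (i, j)" .
    qed (use A mult_closed one_closed in auto)
  qed (use mult_closed one_closed in auto)
  fix A B C assume *: "A \<in> carrier ?M" "B \<in> carrier ?M" "C \<in> carrier ?M"
  show "(A \<oplus>\<^bsub>?M\<^esub> B) \<otimes>\<^bsub>?M\<^esub> C = (A \<otimes>\<^bsub>?M\<^esub> C) \<oplus>\<^bsub>?M\<^esub> (B \<otimes>\<^bsub>?M\<^esub> C)"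
  proof (rule ext)
    fix i j assume ij: "i \<in> {1..n}" "j \<in> {1..n}"
    note e = entry[OF *(1)] entry[OF *(2)] entry[OF *(3)]
    have "((A \<oplus>\<^bsub>?M\<^esub> B) \<otimes>\<^bsub>?M\<^esub> C) (i, j) = (\<Oplus>l\<in>{1..n}. A (i, l) \<otimes> C (l, j) \<oplus> B (i, l) \<otimes> C (l, j))"
      unfolding mult[OF ij] using ij e by (intro finsum_cong') (auto simp: add l_distr)
    also have "\<dots> = (\<Oplus>l\<in>{1..n}. A (i, l) \<otimes> C (l, j)) \<oplus> (\<Oplus>l\<in>{1..n}. B (i, l) \<otimes> C (l, j))"
      using ij e by (intro finsum_addf) auto
    also have "\<dots> = ((A \<otimes>\<^bsub>?M\<^esub> C) \<oplus>\<^bsub>?M\<^esub> (B \<otimes>\<^bsub>?M\<^esub> C)) (i, j)"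
      using ij by (simp only: mult add)
    finally show "((A \<oplus>\<^bsub>?M\<^esub> B) \<otimes>\<^bsub>?M\<^esub> C) (i, j) = ((A \<otimes>\<^bsub>?M\<^esub> C) \<oplus>\<^bsub>?M\<^esub> (B \<otimes>\<^bsub>?M\<^esub> C)) (i, j)" .
  qed (use * mult_closed add_closed in auto)
  show "C \<otimes>\<^bsub>?M\<^esub> (A \<oplus>\<^bsub>?M\<^esub> B) = (C \<otimes>\<^bsub>?M\<^esub> A) \<oplus>\<^bsub>?M\<^esub> (C \<otimes>\<^bsub>?M\<^esub> B)"
  proof (rule ext)
    fix i j assume ij: "i \<in> {1..n}" "j \<in> {1..n}"
    note e = entry[OF *(1)] entry[OF *(2)] entry[OF *(3)]
    have "(C \<otimes>\<^bsub>?M\<^esub> (A \<oplus>\<^bsub>?M\<^esub> B)) (i, j) = (\<Oplus>l\<in>{1..n}. C (i, l) \<otimes> A (l, j) \<oplus> C (i, l) \<otimes> B (l, j))"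
      unfolding mult[OF ij] using ij e by (intro finsum_cong') (auto simp: add r_distr)
    also have "\<dots> = (\<Oplus>l\<in>{1..n}. C (i, l) \<otimes> A (l, j)) \<oplus> (\<Oplus>l\<in>{1..n}. C (i, l) \<otimes> B (l, j))"
      using ij e by (intro finsum_addf) auto
    also have "\<dots> = ((C \<otimes>\<^bsub>?M\<^esub> A) \<oplus>\<^bsub>?M\<^esub> (C \<otimes>\<^bsub>?M\<^esub> B)) (i, j)"
      using ij by (simp only: mult add)
    finally show "(C \<otimes>\<^bsub>?M\<^esub> (A \<oplus>\<^bsub>?M\<^esub> B)) (i, j) = ((C \<otimes>\<^bsub>?M\<^esub> A) \<oplus>\<^bsub>?M\<^esub> (C \<otimes>\<^bsub>?M\<^esub> B)) (i, j)" .
  qed (use * mult_closed add_closed in auto)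
qed

end

end

theory Submission
  imports Defs
begin

text \<open>
  In \<open>E\<^sup>m\<close> all commutators are central and, each being a sum of terms of degree at least \<open>2\<close>, any
  product of \<open>r = \<lfloor>m/2\<rfloor> + 1\<close> of them vanishes. These two facts suffice. An entry of \<open>d\<^sub>k\<close> is a sum of
  alternating sums \<open>\<Sum>\<^sub>\<pi> (-1)\<^sup>\<pi> c\<^sub>0 x\<^bsub>\<pi>(1)\<^esub>(p\<^sub>1) c\<^sub>1 \<dots> x\<^bsub>\<pi>(k)\<^esub>(p\<^sub>k) c\<^sub>k\<close> with at most \<open>n\<^sup>2\<close> distinct matrix positions
  \<open>p\<^sub>t\<close>. Exchanging adjacent factors changes such a sum by a sign, up to terms in which one commutator is
  pulled out and at most two of the factors \<open>x\<close> are used up; two adjacent factors with the same position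
  give only terms of this kind. While more than \<open>n\<^sup>2\<close> factors remain, some position is repeated, so
  \<open>k = n\<^sup>2 + 2r - 1\<close> factors allow \<open>r\<close> commutators to be pulled out.
\<close>

subsection \<open>Commutators and alternating sums\<close>

context ring
begin

section \<open>Commutators and powers of the commutator ideal\<close>

definition commutator :: "'a \<Rightarrow> 'a \<Rightarrow> 'a" where
  "commutator a b = a \<otimes> b \<ominus> b \<otimes> a"

lemma commutator_closed [simp]:
  "a \<in> carrier R \<Longrightarrow> b \<in> carrier R \<Longrightarrow> commutator a b \<in> carrier R"
  by (simp add: commutator_def)

lemma mult_eq_commutator:
  "a \<in> carrier R \<Longrightarrow> b \<in> carrier R \<Longrightarrow> a \<otimes> b = b \<otimes> a \<oplus> commutator a b"
  unfolding commutator_def by algebra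

text \<open>The additive span of products of \<open>r\<close> commutators followed by an arbitrary
  ring element. Once commutators are central this is the \<open>r\<close>-th power of the commutator
  ideal. The closure rules are the ones that manipulating alternating sums calls for.\<close>

inductive comm_ideal :: "nat \<Rightarrow> 'a \<Rightarrow> bool" where
  carrier: "a \<in> carrier R \<Longrightarrow> comm_ideal 0 a"
| zero: "comm_ideal r \<zero>"
| add: "comm_ideal r a \<Longrightarrow> comm_ideal r b \<Longrightarrow> comm_ideal r (a \<oplus> b)"
| minus: "comm_ideal r a \<Longrightarrow> comm_ideal r (\<ominus> a)"
| mult: "a \<in> carrier R \<Longrightarrow> b \<in> carrier R \<Longrightarrow> comm_ideal r e \<Longrightarrow>
    comm_ideal (Suc r) (commutator a b \<otimes> e)"

lemma comm_ideal_closed: "comm_ideal r a \<Longrightarrow> a \<in> carrier R"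
  by (induction rule: comm_ideal.induct) auto

lemma comm_ideal_finsum:
  assumes "finite A" "\<And>i. i \<in> A \<Longrightarrow> comm_ideal r (f i)"
  shows "comm_ideal r (\<Oplus>i\<in>A. f i)"
  using assms
proof (induction A rule: finite_induct)
  case (insert i A)
  then have "(\<Oplus>i\<in>insert i A. f i) = f i \<oplus> (\<Oplus>i\<in>A. f i)"
    by (intro finsum_insert) (auto intro: comm_ideal_closed)
  then show ?case
    using insert by (auto intro!: comm_ideal.add)
qed (simp add: comm_ideal.zero)

section \<open>Signed sums over the symmetric group\<close>

definition alt_sum :: "nat \<Rightarrow> ((nat \<Rightarrow> nat) \<Rightarrow> 'a) \<Rightarrow> 'a" where
  "alt_sum k h = (\<Oplus>\<pi>\<in>{\<pi>. \<pi> permutes {1..k}}. [sign \<pi>] \<cdot> h \<pi>)"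

lemma alt_sum_closed:
  assumes "\<And>\<pi>. \<pi> permutes {1..k} \<Longrightarrow> h \<pi> \<in> carrier R"
  shows "alt_sum k h \<in> carrier R"
  unfolding alt_sum_def using assms by (auto intro!: finsum_closed)

lemma alt_sum_cong:
  assumes "\<And>\<pi>. \<pi> permutes {1..k} \<Longrightarrow> h \<pi> = h' \<pi>"
    and "\<And>\<pi>. \<pi> permutes {1..k} \<Longrightarrow> h' \<pi> \<in> carrier R"
  shows "alt_sum k h = alt_sum k h'"
  unfolding alt_sum_def using assms by (auto intro!: finsum_cong')

lemma alt_sum_zero: "alt_sum k (\<lambda>\<pi>. \<zero>) = \<zero>"
  unfolding alt_sum_def by (intro add.finprod_one_eqI) simp

lemma alt_sum_add:
  assumes "\<And>\<pi>. \<pi> permutes {1..k} \<Longrightarrow> g \<pi> \<in> carrier R"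
    and "\<And>\<pi>. \<pi> permutes {1..k} \<Longrightarrow> h \<pi> \<in> carrier R"
  shows "alt_sum k (\<lambda>\<pi>. g \<pi> \<oplus> h \<pi>) = alt_sum k g \<oplus> alt_sum k h"
proof -
  have "alt_sum k (\<lambda>\<pi>. g \<pi> \<oplus> h \<pi>) =
      (\<Oplus>\<pi>\<in>{\<pi>. \<pi> permutes {1..k}}. [sign \<pi>] \<cdot> g \<pi> \<oplus> [sign \<pi>] \<cdot> h \<pi>)"
    unfolding alt_sum_def using assms by (intro finsum_cong') (auto simp: add.int_pow_distrib)
  then show ?thesis
    unfolding alt_sum_def using assms by (subst (asm) finsum_addf) auto
qed

lemma alt_sum_minus:
  assumes "\<And>\<pi>. \<pi> permutes {1..k} \<Longrightarrow> h \<pi> \<in> carrier R"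
  shows "alt_sum k (\<lambda>\<pi>. \<ominus> h \<pi>) = \<ominus> alt_sum k h"
proof -
  have "alt_sum k (\<lambda>\<pi>. \<ominus> h \<pi>) \<oplus> alt_sum k h = alt_sum k (\<lambda>\<pi>. \<ominus> h \<pi> \<oplus> h \<pi>)"
    using assms by (subst alt_sum_add) auto
  also have "\<dots> = \<zero>"
    using assms by (subst alt_sum_zero[of k, symmetric]) (intro alt_sum_cong, auto simp: l_neg)
  finally show ?thesis
    using assms by (intro minus_equality[symmetric]) (auto intro!: alt_sum_closed)
qed

lemma alt_sum_mult_left:
  assumes "\<And>\<pi>. \<pi> permutes {1..k} \<Longrightarrow> h \<pi> \<in> carrier R" "a \<in> carrier R"
  shows "alt_sum k (\<lambda>\<pi>. a \<otimes> h \<pi>) = a \<otimes> alt_sum k h"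
proof -
  have "a \<otimes> alt_sum k h = (\<Oplus>\<pi>\<in>{\<pi>. \<pi> permutes {1..k}}. a \<otimes> ([sign \<pi>] \<cdot> h \<pi>))"
    unfolding alt_sum_def using assms by (intro finsum_rdistr) (auto intro: finite_permutations)
  also have "\<dots> = alt_sum k (\<lambda>\<pi>. a \<otimes> h \<pi>)"
    unfolding alt_sum_def using assms by (intro finsum_cong') (auto simp: add_pow_rdistr_int)
  finally show ?thesis ..
qed

lemma alt_sum_finsum:
  assumes "finite A" "\<And>i \<pi>. i \<in> A \<Longrightarrow> \<pi> permutes {1..k} \<Longrightarrow> h i \<pi> \<in> carrier R"
  shows "alt_sum k (\<lambda>\<pi>. \<Oplus>i\<in>A. h i \<pi>) = (\<Oplus>i\<in>A. alt_sum k (h i))"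
  using assms
proof (induction A rule: finite_induct)
  case (insert i A)
  have "alt_sum k (\<lambda>\<pi>. \<Oplus>i\<in>insert i A. h i \<pi>) = alt_sum k (\<lambda>\<pi>. h i \<pi> \<oplus> (\<Oplus>i\<in>A. h i \<pi>))"
    using insert by (intro alt_sum_cong) (auto simp: finsum_insert Pi_def intro!: finsum_closed)
  also have "\<dots> = alt_sum k (h i) \<oplus> alt_sum k (\<lambda>\<pi>. \<Oplus>i\<in>A. h i \<pi>)"
    using insert.prems by (intro alt_sum_add) (auto intro!: finsum_closed)
  also have "\<dots> = (\<Oplus>i\<in>insert i A. alt_sum k (h i))"
    using insert by (subst finsum_insert) (auto intro!: alt_sum_closed)
  finally show ?case .
qed (simp add: alt_sum_zero)

text \<open>Composition with a transposition permutes the index set and flips every sign. Composing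
  on the right exchanges the slots \<open>s\<close> and \<open>t\<close> rather than two values,
  which is what swapping two factors of a monomial does.\<close>

lemma alt_sum_transpose:
  assumes "\<And>\<pi>. \<pi> permutes {1..k} \<Longrightarrow> h \<pi> \<in> carrier R"
    and st: "s \<in> {1..k}" "t \<in> {1..k}" "s \<noteq> t"
  shows "alt_sum k (\<lambda>\<pi>. h (\<pi> \<circ> transpose s t)) = \<ominus> alt_sum k h"
proof -
  let ?P = "{\<pi>. \<pi> permutes {1..k}}" and ?\<tau> = "transpose s t"
  have \<tau>: "\<pi> \<circ> ?\<tau> permutes {1..k}" if "\<pi> permutes {1..k}" for \<pi>
    using that st by (intro permutes_compose permutes_swap_id) auto
  have sgn: "sign (\<pi> \<circ> ?\<tau>) = - sign \<pi>" if "\<pi> permutes {1..k}" for \<pi>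
    using that st permutation_permutes[of \<pi>]
    by (subst sign_compose) (auto simp: sign_swap_id permutation_swap_id)
  have "bij_betw (\<lambda>\<pi>. \<pi> \<circ> ?\<tau>) ?P ?P"
    by (rule bij_betw_byWitness[where f' = "\<lambda>\<pi>. \<pi> \<circ> ?\<tau>"])
      (use \<tau> in \<open>auto simp: o_assoc[symmetric]\<close>)
  then have "alt_sum k h = (\<Oplus>\<pi>\<in>?P. [sign (\<pi> \<circ> ?\<tau>)] \<cdot> h (\<pi> \<circ> ?\<tau>))"
    unfolding alt_sum_def using assms by (subst finsum_bij) auto
  also have "\<dots> = alt_sum k (\<lambda>\<pi>. \<ominus> h (\<pi> \<circ> ?\<tau>))"
    unfolding alt_sum_def
    by (intro finsum_cong') (use assms sgn \<tau> in \<open>auto simp: add.int_pow_neg add.int_pow_inv\<close>)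
  also have "\<dots> = \<ominus> alt_sum k (\<lambda>\<pi>. h (\<pi> \<circ> ?\<tau>))"
    using assms \<tau> by (intro alt_sum_minus) auto
  moreover have "alt_sum k (\<lambda>\<pi>. h (\<pi> \<circ> ?\<tau>)) \<in> carrier R"
    using assms \<tau> by (intro alt_sum_closed) auto
  ultimately show ?thesis
    using minus_minus by simp
qed

text \<open>The commutator depends on \<pi>, so it cannot simply leave the sum. Splitting the
  permutations by their values at \<open>s\<close> and \<open>t\<close> makes it constant on each
  class. The case \<open>s = t\<close> is allowed and serves the commutator of a slot with a
  coefficient.\<close>

lemma alt_sum_commutator:
  assumes st: "s \<in> {1..k}" "t \<in> {1..k}"
    and h: "\<And>\<pi>. \<pi> permutes {1..k} \<Longrightarrow> h \<pi> \<in> carrier R"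
    and ab: "\<And>i. a i \<in> carrier R" "\<And>i. b i \<in> carrier R"
    and ideal: "\<And>i j. comm_ideal r (alt_sum k (\<lambda>\<pi>. if \<pi> s = i \<and> \<pi> t = j then h \<pi> else \<zero>))"
  shows "comm_ideal (Suc r) (alt_sum k (\<lambda>\<pi>. commutator (a (\<pi> s)) (b (\<pi> t)) \<otimes> h \<pi>))"
proof -
  let ?I = "{1..k} \<times> {1..k}"
  let ?g = "\<lambda>q \<pi>. if \<pi> s = fst q \<and> \<pi> t = snd q then h \<pi> else \<zero>"
  let ?c = "\<lambda>q. commutator (a (fst q)) (b (snd q))"
  \<comment> \<open>Exactly one pair \<open>q\<close> matches the two values of \<pi>; all other
    terms vanish.\<close>
  have "commutator (a (\<pi> s)) (b (\<pi> t)) \<otimes> h \<pi> = (\<Oplus>q\<in>?I. ?c q \<otimes> ?g q \<pi>)"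
    if "\<pi> permutes {1..k}" for \<pi>
  proof -
    have "(\<Oplus>q\<in>?I. ?c q \<otimes> ?g q \<pi>) =
        (\<Oplus>q\<in>?I. if (\<pi> s, \<pi> t) = q then ?c q \<otimes> h \<pi> else \<zero>)"
      using h[OF that] ab by (intro finsum_cong') auto
    also have "\<dots> = ?c (\<pi> s, \<pi> t) \<otimes> h \<pi>"
    proof (rule finsum_singleton)
      show "(\<pi> s, \<pi> t) \<in> ?I"
        using permutes_in_image[OF that] st by blast
    qed (use h[OF that] ab in auto)
    finally show ?thesis
      by simp
  qed
  then have "alt_sum k (\<lambda>\<pi>. commutator (a (\<pi> s)) (b (\<pi> t)) \<otimes> h \<pi>) =
      alt_sum k (\<lambda>\<pi>. \<Oplus>q\<in>?I. ?c q \<otimes> ?g q \<pi>)"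
    using h ab by (intro alt_sum_cong) (auto intro!: finsum_closed)
  also have "\<dots> = (\<Oplus>q\<in>?I. alt_sum k (\<lambda>\<pi>. ?c q \<otimes> ?g q \<pi>))"
    using h ab by (intro alt_sum_finsum) auto
  also have "\<dots> = (\<Oplus>q\<in>?I. ?c q \<otimes> alt_sum k (?g q))"
  proof -
    have "alt_sum k (\<lambda>\<pi>. ?c q \<otimes> ?g q \<pi>) = ?c q \<otimes> alt_sum k (?g q)" for q
      by (rule alt_sum_mult_left) (use h ab in auto)
    then show ?thesis
      by simp
  qed
  finally show ?thesis
    using ideal ab by (auto intro!: comm_ideal_finsum comm_ideal.mult)
qed

end

subsection \<open>Words\<close>

text \<open>A word stands for a monomial with placeholders: \<open>Coef a\<close> is a ring element, and
  the \<open>t\<close>-th of the remaining letters is a slot that receives the index \<open>\<pi> t\<close>. The slot \<open>Var p\<close>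
  contributes \<open>z (\<pi> t) p\<close>; the slot \<open>Fixed i\<close> contributes \<open>1\<close> if \<open>\<pi> t = i\<close> and \<open>0\<close> otherwise, so it
  remembers an index that was spent on a commutator already pulled out.\<close>

datatype ('a, 'p) letter = Coef 'a | Var 'p | Fixed nat

primrec slots :: "('a, 'p) letter list \<Rightarrow> nat" where
  "slots [] = 0"
| "slots (L # w) = (case L of Coef a \<Rightarrow> slots w | Var p \<Rightarrow> Suc (slots w) | Fixed i \<Rightarrow> Suc (slots w))"

primrec vars :: "('a, 'p) letter list \<Rightarrow> 'p list" where
  "vars [] = []"
| "vars (L # w) = (case L of Coef a \<Rightarrow> vars w | Var p \<Rightarrow> p # vars w | Fixed i \<Rightarrow> vars w)"

lemma slots_append [simp]: "slots (u @ v) = slots u + slots v"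
  by (induction u) (auto split: letter.splits)

lemma vars_append [simp]: "vars (u @ v) = vars u @ vars v"
  by (induction u) (auto split: letter.splits)

lemma in_vars_split: "p \<in> set (vars w) \<Longrightarrow> \<exists>u v. w = u @ Var p # v"
proof (induction w)
  case (Cons L w)
  show ?case
  proof (cases "L = Var p")
    case False
    then have "p \<in> set (vars w)"
      using Cons.prems by (auto split: letter.splits)
    then obtain u v where "w = u @ Var p # v"
      using Cons.IH by blast
    then have "L # w = (L # u) @ Var p # v"
      by simp
    then show ?thesis
      by blast
  qed blast
qed simp

lemma repeated_var_split:
  "\<not> distinct (vars w) \<Longrightarrow> \<exists>u p v v'. w = u @ Var p # v @ Var p # v'"
proof (induction w)
  case (Cons L w)
  show ?case
  proof (cases "distinct (vars w)")
    case True
    then obtain p where p: "L = Var p" "p \<in> set (vars w)"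
      using Cons.prems by (auto split: letter.splits)
    then obtain v v' where "w = v @ Var p # v'"
      using in_vars_split by fastforce
    then have "L # w = [] @ Var p # v @ Var p # v'"
      using p by simp
    then show ?thesis
      by blast
  next
    case False
    then obtain u p v v' where "w = u @ Var p # v @ Var p # v'"
      using Cons.IH by blast
    then have "L # w = (L # u) @ Var p # v @ Var p # v'"
      by simp
    then show ?thesis
      by blast
  qed
qed simp

section \<open>Values of words in a ring with central commutators\<close>

locale central_commutators = ring +
  assumes commutator_central:
    "\<lbrakk>a \<in> carrier R; b \<in> carrier R; c \<in> carrier R\<rbrakk> \<Longrightarrow> commutator a b \<otimes> c = c \<otimes> commutator a b"
begin

text \<open>Write ab = ba + [a,b]; centrality carries the commutator past \<open>u\<close> to the
  front, where \<open>comm_ideal\<close> expects it. The right-nested products match the unfolding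
  of \<open>word_value\<close>.\<close>

lemma mult_swap_commutator:
  assumes "u \<in> carrier R" "a \<in> carrier R" "b \<in> carrier R" "v \<in> carrier R"
  shows "u \<otimes> (a \<otimes> (b \<otimes> v)) = u \<otimes> (b \<otimes> (a \<otimes> v)) \<oplus> commutator a b \<otimes> (u \<otimes> v)"
proof -
  have "u \<otimes> (a \<otimes> (b \<otimes> v)) = u \<otimes> ((a \<otimes> b) \<otimes> v)"
    using assms by (simp add: m_assoc)
  also have "\<dots> = u \<otimes> (b \<otimes> (a \<otimes> v)) \<oplus> (u \<otimes> commutator a b) \<otimes> v"
    using assms by (simp add: mult_eq_commutator[of a b] m_assoc l_distr r_distr)
  also have "(u \<otimes> commutator a b) \<otimes> v = commutator a b \<otimes> (u \<otimes> v)"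
    using assms by (simp add: commutator_central[symmetric] m_assoc)
  finally show ?thesis .
qed

end

locale word_values = central_commutators R for R :: "('a, 'b) ring_scheme" (structure) +
  fixes z :: "nat \<Rightarrow> 'p \<Rightarrow> 'a"
  assumes z_closed [simp]: "z i p \<in> carrier R"
begin

text \<open>The argument \<open>j\<close> counts the slots to the left of the word.\<close>

primrec word_value :: "('a, 'p) letter list \<Rightarrow> (nat \<Rightarrow> nat) \<Rightarrow> nat \<Rightarrow> 'a" where
  "word_value [] f j = \<one>"
| "word_value (L # w) f j =
    (case L of
       Coef a \<Rightarrow> a \<otimes> word_value w f j
     | Var p \<Rightarrow> z (f (Suc j)) p \<otimes> word_value w f (Suc j)
     | Fixed i \<Rightarrow> if f (Suc j) = i then word_value w f (Suc j) else \<zero>)"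

definition good_word :: "('a, 'p) letter list \<Rightarrow> bool" where
  "good_word w \<longleftrightarrow> (\<forall>a. Coef a \<in> set w \<longrightarrow> a \<in> carrier R)"

lemma good_word_simps [simp]:
  "good_word []"
  "good_word (Coef a # w) \<longleftrightarrow> a \<in> carrier R \<and> good_word w"
  "good_word (Var p # w) \<longleftrightarrow> good_word w"
  "good_word (Fixed i # w) \<longleftrightarrow> good_word w"
  "good_word (u @ w) \<longleftrightarrow> good_word u \<and> good_word w"
  by (auto simp: good_word_def)

lemma word_value_closed [simp]: "good_word w \<Longrightarrow> word_value w f j \<in> carrier R"
proof (induction w arbitrary: j)
  case (Cons L w)
  then show ?case
    by (cases L) auto
qed simp

lemma word_value_append:
  "good_word u \<Longrightarrow> good_word v \<Longrightarrow>
    word_value (u @ v) f j = word_value u f j \<otimes> word_value v f (j + slots u)"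
proof (induction u arbitrary: j)
  case (Cons L u)
  then show ?case
    by (cases L) (auto simp: m_assoc)
qed simp

lemma word_value_cong:
  "(\<And>i. j < i \<Longrightarrow> i \<le> j + slots w \<Longrightarrow> f i = g i) \<Longrightarrow> word_value w f j = word_value w g j"
proof (induction w arbitrary: j)
  case (Cons L w)
  have "word_value w f (Suc j) = word_value w g (Suc j)" if "\<And>a. L \<noteq> Coef a"
    using that Cons.prems by (intro Cons.IH) (auto split: letter.splits)
  moreover have "word_value w f j = word_value w g j" if "L = Coef a" for a
    using that Cons.prems by (intro Cons.IH) auto
  ultimately show ?case
    using Cons.prems[of "Suc j"] by (cases L) auto
qed simp

section \<open>Exchanging adjacent letters under the alternating sum\<close>

abbreviation word_sum :: "nat \<Rightarrow> ('a, 'p) letter list \<Rightarrow> 'a" where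
  "word_sum k w \<equiv> alt_sum k (\<lambda>\<pi>. word_value w \<pi> 0)"

text \<open>As za = az + [z,a], the exchange costs one commutator term. That term uses up the slot
  of \<open>Var p\<close>, whose index is remembered by \<open>Fixed i\<close>, so the number of
  slots stays \<open>k\<close>.\<close>

lemma word_sum_swap_Coef:
  assumes good: "good_word u" "good_word v" "a \<in> carrier R" and k: "k = Suc (slots u + slots v)"
    and fixed: "\<And>i. comm_ideal r (word_sum k (u @ Fixed i # v))"
    and swapped: "comm_ideal (Suc r) (word_sum k (u @ Coef a # Var p # v))"
  shows "comm_ideal (Suc r) (word_sum k (u @ Var p # Coef a # v))"
proof -
  let ?s = "Suc (slots u)"
  let ?uv = "\<lambda>\<pi>. word_value u \<pi> 0 \<otimes> word_value v \<pi> ?s"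
  have "word_sum k (u @ Var p # Coef a # v) = alt_sum k (\<lambda>\<pi>.
      word_value (u @ Coef a # Var p # v) \<pi> 0 \<oplus> commutator (z (\<pi> ?s) p) a \<otimes> ?uv \<pi>)"
    using good by (intro alt_sum_cong) (auto simp: word_value_append mult_swap_commutator[symmetric])
  also have "\<dots> = word_sum k (u @ Coef a # Var p # v) \<oplus>
      alt_sum k (\<lambda>\<pi>. commutator (z (\<pi> ?s) p) a \<otimes> ?uv \<pi>)"
    using good by (intro alt_sum_add) auto
  finally have eq: "word_sum k (u @ Var p # Coef a # v) = \<dots>" .
  have "comm_ideal (Suc r) (alt_sum k (\<lambda>\<pi>. commutator (z (\<pi> ?s) p) a \<otimes> ?uv \<pi>))"
  proof (rule alt_sum_commutator[of ?s _ ?s _ "\<lambda>i. z i p" "\<lambda>_. a"])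
    fix i j
    have "comm_ideal r (alt_sum k (\<lambda>\<pi>. if \<pi> ?s = i then ?uv \<pi> else \<zero>))"
    proof -
      have "(\<lambda>\<pi>. word_value (u @ Fixed i # v) \<pi> 0) = (\<lambda>\<pi>. if \<pi> ?s = i then ?uv \<pi> else \<zero>)"
        using good by (auto simp: word_value_append)
      then show ?thesis
        using fixed[of i] by simp
    qed
    \<comment> \<open>Both indices are read from the same slot, so the two conditions conflict
      unless \<open>i = j\<close>.\<close>
    then show "comm_ideal r (alt_sum k (\<lambda>\<pi>. if \<pi> ?s = i \<and> \<pi> ?s = j then ?uv \<pi> else \<zero>))"
      by (cases "i = j") (auto simp: alt_sum_zero comm_ideal.zero cong: conj_cong)
  qed (use good k in auto)
  then show ?thesis
    unfolding eq using swapped by (rule comm_ideal.add[rotated])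
qed

text \<open>\<open>u\<close> reads only slots below \<open>s\<close> and \<open>v\<close> only slots
  above \<open>Suc s\<close>; the transposition fixes both ranges.\<close>

lemma word_value_transpose:
  assumes "good_word u" "good_word v"
  defines "s \<equiv> Suc (slots u)"
  shows "word_value u (f \<circ> transpose s (Suc s)) 0 = word_value u f 0"
    and "word_value v (f \<circ> transpose s (Suc s)) (Suc s) = word_value v f (Suc s)"
  by (rule word_value_cong; simp add: s_def transpose_def)+

text \<open>A \<open>Fixed\<close> letter contributes only 0 or 1, so no commutator arises. It still
  occupies a slot, and exchanging the two slots changes the sign.\<close>

lemma word_sum_swap_Fixed:
  assumes good: "good_word u" "good_word v" and k: "k = Suc (Suc (slots u + slots v))"
  shows "word_sum k (u @ Var p # Fixed i # v) = \<ominus> word_sum k (u @ Fixed i # Var p # v)"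
proof -
  let ?s = "Suc (slots u)"
  have "word_sum k (u @ Var p # Fixed i # v) =
      alt_sum k (\<lambda>\<pi>. word_value (u @ Fixed i # Var p # v) (\<pi> \<circ> transpose ?s (Suc ?s)) 0)"
    using good word_value_transpose[OF good] by (intro alt_sum_cong) (auto simp: word_value_append)
  also have "\<dots> = \<ominus> word_sum k (u @ Fixed i # Var p # v)"
    using good k by (intro alt_sum_transpose) auto
  finally show ?thesis .
qed

text \<open>Two variables are spent on one commutator and leave \<open>Fixed\<close> letters behind.
  The filter \<open>P\<close> on their indices is trivial for an exchange of letters and is
  \<open><\<close> for a square.\<close>

lemma comm_ideal_commutator_Fixed:
  assumes good: "good_word u" "good_word v" and k: "k = Suc (Suc (slots u + slots v))"
    and fixed: "\<And>i j. P i j \<Longrightarrow> comm_ideal r (word_sum k (u @ Fixed i # Fixed j # v))"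
  defines "s \<equiv> Suc (slots u)"
  shows "comm_ideal (Suc r) (alt_sum k (\<lambda>\<pi>. commutator (z (\<pi> s) p) (z (\<pi> (Suc s)) q) \<otimes>
      (if P (\<pi> s) (\<pi> (Suc s)) then word_value u \<pi> 0 \<otimes> word_value v \<pi> (Suc s) else \<zero>)))"
proof (rule alt_sum_commutator)
  let ?uv = "\<lambda>\<pi>. word_value u \<pi> 0 \<otimes> word_value v \<pi> (Suc s)"
  fix i j
  show "comm_ideal r (alt_sum k (\<lambda>\<pi>. if \<pi> s = i \<and> \<pi> (Suc s) = j then
      if P (\<pi> s) (\<pi> (Suc s)) then ?uv \<pi> else \<zero> else \<zero>))" (is "comm_ideal r (alt_sum k ?h)")
  proof (cases "P i j")
    case True
    then have "?h = (\<lambda>\<pi>. word_value (u @ Fixed i # Fixed j # v) \<pi> 0)"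
      using good by (auto simp: word_value_append s_def)
    then show ?thesis
      using fixed[OF True] by simp
  next
    case False
    then have "?h = (\<lambda>\<pi>. \<zero>)"
      by auto
    then show ?thesis
      by (simp add: alt_sum_zero comm_ideal.zero)
  qed
qed (use good k in \<open>auto simp: s_def\<close>)

text \<open>Replacing ab by ba + [a,b] reverses the letters while each keeps its index, so the slots
  have to be transposed too; this accounts for the sign of the swapped sum.\<close>

lemma word_sum_swap_Var:
  assumes good: "good_word u" "good_word v" and k: "k = Suc (Suc (slots u + slots v))"
    and fixed: "\<And>i j. comm_ideal r (word_sum k (u @ Fixed i # Fixed j # v))"
    and swapped: "comm_ideal (Suc r) (word_sum k (u @ Var q # Var p # v))"
  shows "comm_ideal (Suc r) (word_sum k (u @ Var p # Var q # v))"
proof -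
  let ?s = "Suc (slots u)"
  let ?w = "\<lambda>\<pi>. word_value (u @ Var q # Var p # v) (\<pi> \<circ> transpose ?s (Suc ?s)) 0"
  let ?c = "\<lambda>\<pi>. commutator (z (\<pi> ?s) p) (z (\<pi> (Suc ?s)) q) \<otimes>
    (word_value u \<pi> 0 \<otimes> word_value v \<pi> (Suc ?s))"
  have "word_sum k (u @ Var p # Var q # v) = alt_sum k (\<lambda>\<pi>. ?w \<pi> \<oplus> ?c \<pi>)"
    using good word_value_transpose[OF good]
    by (intro alt_sum_cong) (auto simp: word_value_append mult_swap_commutator[symmetric])
  also have "\<dots> = alt_sum k ?w \<oplus> alt_sum k ?c"
    using good by (intro alt_sum_add) auto
  also have "alt_sum k ?w = \<ominus> word_sum k (u @ Var q # Var p # v)"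
    using good k by (intro alt_sum_transpose) auto
  finally show ?thesis
    using swapped comm_ideal_commutator_Fixed[OF good k, of "\<lambda>_ _. True" r p q] fixed
    by (simp add: comm_ideal.add comm_ideal.minus)
qed

text \<open>Pairing \<open>\<pi>\<close> with its composition with the transposition of the two slots avoids
  a division by \<open>2\<close>.\<close>

lemma word_sum_square:
  assumes good: "good_word u" "good_word v" and k: "k = Suc (Suc (slots u + slots v))"
    and fixed: "\<And>i j. comm_ideal r (word_sum k (u @ Fixed i # Fixed j # v))"
  shows "comm_ideal (Suc r) (word_sum k (u @ Var p # Var p # v))"
proof -
  let ?s = "Suc (slots u)"
  let ?\<tau> = "transpose ?s (Suc ?s)"
  let ?w = "\<lambda>\<pi>. word_value (u @ Var p # Var p # v) \<pi> 0"
  let ?lt = "\<lambda>\<pi>. if \<pi> ?s < \<pi> (Suc ?s) then ?w \<pi> else \<zero>"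
  let ?gt = "\<lambda>\<pi>. if \<pi> (Suc ?s) < \<pi> ?s then ?w \<pi> else \<zero>"
  let ?c = "\<lambda>\<pi>. commutator (z (\<pi> ?s) p) (z (\<pi> (Suc ?s)) p) \<otimes>
    (if \<pi> ?s < \<pi> (Suc ?s) then word_value u \<pi> 0 \<otimes> word_value v \<pi> (Suc ?s) else \<zero>)"
  have "word_sum k (u @ Var p # Var p # v) = alt_sum k (\<lambda>\<pi>. ?lt \<pi> \<oplus> ?gt \<pi>)"
  proof (rule alt_sum_cong)
    fix \<pi> assume "\<pi> permutes {1..k}"
    then have "\<pi> ?s \<noteq> \<pi> (Suc ?s)"
      using permutes_inj[of \<pi>] by (metis inj_eq n_not_Suc_n)
    then show "?w \<pi> = ?lt \<pi> \<oplus> ?gt \<pi>"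
      using good by auto
  qed (use good in auto)
  also have "\<dots> = alt_sum k ?lt \<oplus> alt_sum k ?gt"
    using good by (intro alt_sum_add) auto
  also have "alt_sum k ?gt = \<ominus> alt_sum k (\<lambda>\<pi>. ?gt (\<pi> \<circ> ?\<tau>))"
  proof -
    have "alt_sum k (\<lambda>\<pi>. ?gt (\<pi> \<circ> ?\<tau>)) = \<ominus> alt_sum k ?gt"
      by (rule alt_sum_transpose) (use good k in auto)
    moreover have "alt_sum k ?gt \<in> carrier R"
      using good by (intro alt_sum_closed) auto
    ultimately show ?thesis
      by simp
  qed
  also have "\<dots> = alt_sum k (\<lambda>\<pi>. \<ominus> ?gt (\<pi> \<circ> ?\<tau>))"
    using good by (intro alt_sum_minus[symmetric]) auto
  also have "alt_sum k ?lt \<oplus> \<dots> = alt_sum k (\<lambda>\<pi>. ?lt \<pi> \<oplus> \<ominus> ?gt (\<pi> \<circ> ?\<tau>))"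
    using good by (intro alt_sum_add[symmetric]) auto
  \<comment> \<open>The transposition swaps the two compared values, so \<open>?gt\<close> composed
    with it has the guard of \<open>?lt\<close>; what remains is ab - ba between \<open>u\<close>
    and \<open>v\<close>.\<close>
  also have "\<dots> = alt_sum k ?c"
  proof (rule alt_sum_cong)
    fix \<pi>
    let ?u = "word_value u \<pi> 0" and ?v = "word_value v \<pi> (Suc ?s)"
    let ?a = "z (\<pi> ?s) p" and ?b = "z (\<pi> (Suc ?s)) p"
    have cancel: "x \<oplus> y \<ominus> x = y" if "x \<in> carrier R" "y \<in> carrier R" for x y
      using that by algebra
    have "?u \<otimes> (?a \<otimes> (?b \<otimes> ?v)) \<ominus> ?u \<otimes> (?b \<otimes> (?a \<otimes> ?v)) = commutator ?a ?b \<otimes> (?u \<otimes> ?v)"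
      using good cancel by (subst mult_swap_commutator) auto
    then show "?lt \<pi> \<oplus> \<ominus> ?gt (\<pi> \<circ> ?\<tau>) = ?c \<pi>"
      using good word_value_transpose[OF good, of \<pi>] by (simp add: word_value_append a_minus_def)
  qed (use good in auto)
  finally show ?thesis
    using comm_ideal_commutator_Fixed[OF good k, of "(<)" r p p] fixed by simp
qed

text \<open>Induction on \<open>r\<close>. For \<open>Suc r\<close> the bound leaves more variables
  than elements of \<open>S\<close>, so some variable repeats. Pulling out a commutator spends at
  most two variables, after which the bound for \<open>r\<close> still holds; \<open>Fixed\<close>
  letters keep the slot count at \<open>k\<close>.\<close>

lemma word_sum_in_comm_ideal:
  assumes "finite S"
  shows "good_word w \<Longrightarrow> slots w = k \<Longrightarrow> set (vars w) \<subseteq> S \<Longrightarrow>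
    card S + 2 * r \<le> Suc (length (vars w)) \<Longrightarrow> comm_ideal r (word_sum k w)"
proof (induction r arbitrary: w)
  case 0
  then show ?case
    by (auto intro!: comm_ideal.carrier alt_sum_closed)
next
  case (Suc r)
  \<comment> \<open>The first \<open>Var p\<close> travels right through \<open>v\<close> until it
    meets the second. The bound leaves out these two variables, because two may be lost to a
    commutator.\<close>
  have adjacent: "comm_ideal (Suc r) (word_sum k (u @ Var p # v @ Var p # v'))"
    if "good_word (u @ v @ v')" "Suc (Suc (slots (u @ v @ v'))) = k"
      "insert p (set (vars (u @ v @ v'))) \<subseteq> S" "card S + 2 * r \<le> Suc (length (vars (u @ v @ v')))"
    for u p v v'
    using that
  proof (induction v arbitrary: u)
    case Nil
    then show ?case
      using Suc.IH by (auto intro!: word_sum_square)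
  next
    case (Cons L v)
    \<comment> \<open>The letter that was passed joins the prefix, so the gap \<open>v\<close>
      becomes shorter.\<close>
    have swapped: "comm_ideal (Suc r) (word_sum k (u @ L # Var p # v @ Var p # v'))"
      using Cons.IH[of "u @ [L]"] Cons.prems by (cases L) auto
    show ?case
    proof (cases L)
      case (Coef a)
      show ?thesis
        unfolding append_Cons Coef
        by (rule word_sum_swap_Coef[where r = r]; (rule Suc.IH)?; use Cons.prems swapped Coef in simp)
    next
      case (Var q)
      show ?thesis
        unfolding append_Cons Var
        by (rule word_sum_swap_Var[where r = r]; (rule Suc.IH)?; use Cons.prems swapped Var in simp)
    next
      case (Fixed i)
      then show ?thesis
        using Cons.prems swapped by (simp add: word_sum_swap_Fixed comm_ideal.minus)
    qed
  qed
  have "\<not> distinct (vars w)"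
  proof
    assume "distinct (vars w)"
    then have "length (vars w) \<le> card S"
      using card_mono[OF assms Suc.prems(3)] by (simp add: distinct_card)
    then show False
      using Suc.prems by simp
  qed
  then obtain u p v v' where w: "w = u @ Var p # v @ Var p # v'"
    using repeated_var_split by blast
  show ?case
    unfolding w by (rule adjacent) (use Suc.prems w in auto)
qed

end

subsection \<open>Matrix rings\<close>

context ring
begin

section \<open>Passage from matrices to their entries\<close>

lemma matrix_entry_closed:
  "A \<in> carrier (matrix_ring n R) \<Longrightarrow> p \<in> {1..n} \<times> {1..n} \<Longrightarrow> A p \<in> carrier R"
  by (auto simp: matrix_ring_def)

lemma matrix_entry_mult:
  "a \<in> {1..n} \<Longrightarrow> c \<in> {1..n} \<Longrightarrow>
    (A \<otimes>\<^bsub>matrix_ring n R\<^esub> B) (a, c) = (\<Oplus>l\<in>{1..n}. A (a, l) \<otimes> B (l, c))"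
  by (simp add: matrix_ring_def)

lemma matrix_entry_add:
  "p \<in> {1..n} \<times> {1..n} \<Longrightarrow> (A \<oplus>\<^bsub>matrix_ring n R\<^esub> B) p = A p \<oplus> B p"
  by (auto simp: matrix_ring_def)

lemma matrix_entry_zero: "p \<in> {1..n} \<times> {1..n} \<Longrightarrow> \<zero>\<^bsub>matrix_ring n R\<^esub> p = \<zero>"
  by (auto simp: matrix_ring_def)

lemma matrix_entry_minus:
  assumes "A \<in> carrier (matrix_ring n R)" "p \<in> {1..n} \<times> {1..n}"
  shows "(\<ominus>\<^bsub>matrix_ring n R\<^esub> A) p = \<ominus> A p"
proof -
  interpret M: ring "matrix_ring n R"
    by (rule matrix_ring_ring)
  have "(\<ominus>\<^bsub>matrix_ring n R\<^esub> A) p \<oplus> A p = \<zero>"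
    using assms by (simp add: matrix_entry_add[symmetric] M.l_neg matrix_entry_zero)
  then show ?thesis
    using assms by (intro minus_equality[symmetric]) (auto intro: matrix_entry_closed)
qed

lemma matrix_entry_sign:
  assumes "A \<in> carrier (matrix_ring n R)" "p \<in> {1..n} \<times> {1..n}"
  shows "([sign \<pi>] \<cdot>\<^bsub>matrix_ring n R\<^esub> A) p = [sign \<pi>] \<cdot> A p"
proof -
  interpret M: ring "matrix_ring n R"
    by (rule matrix_ring_ring)
  show ?thesis
    using assms matrix_entry_closed[OF assms]
    by (cases \<pi> rule: sign_cases)
      (simp_all add: M.add.int_pow_neg add.int_pow_neg matrix_entry_minus)
qed

lemma matrix_entry_finsum:
  assumes "finite S" "\<And>i. i \<in> S \<Longrightarrow> A i \<in> carrier (matrix_ring n R)" "p \<in> {1..n} \<times> {1..n}"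
  shows "(\<Oplus>\<^bsub>matrix_ring n R\<^esub>i\<in>S. A i) p = (\<Oplus>i\<in>S. A i p)"
proof -
  interpret M: ring "matrix_ring n R"
    by (rule matrix_ring_ring)
  show ?thesis
    using assms
  proof (induction S rule: finite_induct)
    case (insert i S)
    then have "(\<Oplus>j\<in>insert i S. A j p) = A i p \<oplus> (\<Oplus>j\<in>S. A j p)"
      by (intro finsum_insert) (auto intro!: matrix_entry_closed)
    moreover have "(\<Oplus>\<^bsub>matrix_ring n R\<^esub>j\<in>insert i S. A j) =
        A i \<oplus>\<^bsub>matrix_ring n R\<^esub> (\<Oplus>\<^bsub>matrix_ring n R\<^esub>j\<in>S. A j)"
      using insert by (intro M.finsum_insert) auto
    ultimately show ?case
      using insert by (simp add: matrix_entry_add)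
  qed (simp add: matrix_entry_zero)
qed

end

section \<open>Expansion of the Capelli polynomial into words\<close>

context central_commutators
begin

text \<open>Each entry is a sum of word sums with \<open>k\<close> variables taken from the n^2
  matrix positions, and the equation for \<open>k\<close> is the bound of
  \<open>word_sum_in_comm_ideal\<close> with equality.\<close>

theorem matrix_ring_satisfies_capelli:
  assumes nilpotent: "\<And>a. comm_ideal r a \<Longrightarrow> a = \<zero>" and k: "Suc k = n\<^sup>2 + 2 * r"
  shows "satisfies_capelli (matrix_ring n R) k"
  unfolding satisfies_capelli_def
proof (intro allI impI)
  let ?M = "matrix_ring n R" and ?I = "{1..n} \<times> {1..n}"
  interpret M: ring ?M
    by (rule matrix_ring_ring)
  fix x y
  assume x: "x \<in> {1..k} \<rightarrow> carrier ?M" and y: "y \<in> {0..k} \<rightarrow> carrier ?M"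
  \<comment> \<open>Extension by zero puts the values in the carrier for all indices and positions,
    as \<open>word_values\<close> demands.\<close>
  define z where "z i p = (if i \<in> {1..k} \<and> p \<in> ?I then x i p else \<zero>)" for i p
  interpret word_values R z
  proof
    fix i p
    show "z i p \<in> carrier R"
      using x matrix_entry_closed[of "x i" n p] by (auto simp: z_def Pi_iff)
  qed
  let ?mono = "\<lambda>\<pi> j. capelli_monomial ?M \<pi> x y j"
  have mono_closed: "?mono \<pi> j \<in> carrier ?M" if "\<pi> permutes {1..k}" "j \<le> k" for \<pi> j
    using that(2)
  proof (induction j)
    case (Suc j)
    have "\<pi> (Suc j) \<in> {1..k}"
      using permutes_in_image[OF that(1)] Suc.prems by auto
    then show ?case
      using Suc x y by (auto simp: Pi_iff)
  qed (use y in auto)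
  have y_entry: "y j p \<in> carrier R" if "j \<le> k" "p \<in> ?I" for j p
    using y that by (intro matrix_entry_closed[of _ n]) auto
  have mono_entry: "?mono \<pi> j p \<in> carrier R" if "\<pi> permutes {1..k}" "j \<le> k" "p \<in> ?I" for \<pi> j p
    using mono_closed that by (intro matrix_entry_closed[of _ n]) auto
  \<comment> \<open>The monomial is cut after \<open>y j\<close>: the left part is still a matrix
    product, the right part is already a word whose first slot is \<open>Suc j\<close>. Each
    induction step turns one more pair of factors into letters.\<close>
  have expand: "comm_ideal r (alt_sum k (\<lambda>\<pi>. ?mono \<pi> j (a, c) \<otimes> word_value w \<pi> j))"
    if "j \<le> k" "a \<in> {1..n}" "c \<in> {1..n}" "good_word w" "slots w + j = k"
      "length (vars w) + j = k" "set (vars w) \<subseteq> ?I" for j a c w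
    using that
  proof (induction j arbitrary: c w)
    case 0
    have "comm_ideal r (word_sum k (Coef (y 0 (a, c)) # w))"
      by (rule word_sum_in_comm_ideal[of ?I])
        (use 0 k y_entry in \<open>auto simp: card_cartesian_product power2_eq_square\<close>)
    then show ?case
      by simp
  next
    case (Suc j)
    \<comment> \<open>In the two matrix products, summed over \<open>b\<close> and \<open>d\<close>,
      the entry of x at \<open>(b, d)\<close> becomes a variable and the entry of y at
      \<open>(d, c)\<close> a coefficient.\<close>
    let ?w = "\<lambda>d b. Var (b, d) # Coef (y (Suc j) (d, c)) # w"
    let ?h = "\<lambda>d b \<pi>. ?mono \<pi> j (a, b) \<otimes> word_value (?w d b) \<pi> j"
    have good: "good_word (?w d b)" if "d \<in> {1..n}" for d b
      using Suc.prems that y_entry by auto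
    have closed: "?h d b \<pi> \<in> carrier R"
      if "\<pi> permutes {1..k}" "d \<in> {1..n}" "b \<in> {1..n}" for d b \<pi>
      using good[OF that(2), of b] Suc.prems that by (intro m_closed mono_entry word_value_closed) auto
    have "?mono \<pi> (Suc j) (a, c) \<otimes> word_value w \<pi> (Suc j) = (\<Oplus>d\<in>{1..n}. \<Oplus>b\<in>{1..n}. ?h d b \<pi>)"
      if \<pi>: "\<pi> permutes {1..k}" for \<pi>
    proof -
      let ?W = "word_value w \<pi> (Suc j)"
      have \<pi>j: "\<pi> (Suc j) \<in> {1..k}"
        using permutes_in_image[OF \<pi>] Suc.prems by auto
      have xz: "x (\<pi> (Suc j)) (b, d) = z (\<pi> (Suc j)) (b, d)" if "b \<in> {1..n}" "d \<in> {1..n}" for b d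
        using that \<pi>j by (simp add: z_def)
      have W: "?W \<in> carrier R"
        using Suc.prems by simp
      have m: "?mono \<pi> j (a, b) \<in> carrier R" if "b \<in> {1..n}" for b
        using that Suc.prems \<pi> by (intro mono_entry) auto
      have Y: "y (Suc j) (d, c) \<in> carrier R" if "d \<in> {1..n}" for d
        using that Suc.prems by (intro y_entry) auto
      have "?mono \<pi> (Suc j) (a, c) \<otimes> ?W = (\<Oplus>d\<in>{1..n}. (\<Oplus>b\<in>{1..n}.
          ?mono \<pi> j (a, b) \<otimes> z (\<pi> (Suc j)) (b, d)) \<otimes> y (Suc j) (d, c)) \<otimes> ?W"
        using Suc.prems m Y
        by (auto simp: matrix_entry_mult xz intro!: finsum_cong' arg_cong2[where f = "(\<otimes>)"]
          finsum_closed)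
      also have "\<dots> = (\<Oplus>d\<in>{1..n}. (\<Oplus>b\<in>{1..n}.
          ?mono \<pi> j (a, b) \<otimes> z (\<pi> (Suc j)) (b, d)) \<otimes> (y (Suc j) (d, c) \<otimes> ?W))"
        using m Y W
        by (subst finsum_ldistr) (auto intro!: finsum_cong' finsum_closed simp: m_assoc)
      also have "\<dots> = (\<Oplus>d\<in>{1..n}. \<Oplus>b\<in>{1..n}. ?h d b \<pi>)"
        using m Y W closed[OF \<pi>]
        by (intro finsum_cong') (auto simp: finsum_ldistr m_assoc intro!: finsum_cong' finsum_closed)
      finally show ?thesis .
    qed
    then have "alt_sum k (\<lambda>\<pi>. ?mono \<pi> (Suc j) (a, c) \<otimes> word_value w \<pi> (Suc j)) =
        alt_sum k (\<lambda>\<pi>. \<Oplus>d\<in>{1..n}. \<Oplus>b\<in>{1..n}. ?h d b \<pi>)"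
      using closed by (intro alt_sum_cong) (auto intro!: finsum_closed)
    also have "\<dots> = (\<Oplus>d\<in>{1..n}. alt_sum k (\<lambda>\<pi>. \<Oplus>b\<in>{1..n}. ?h d b \<pi>))"
      using closed by (intro alt_sum_finsum) (auto intro!: finsum_closed)
    also have "comm_ideal r \<dots>"
    proof (intro comm_ideal_finsum finite_atLeastAtMost)
      fix d assume d: "d \<in> {1..n}"
      have "alt_sum k (\<lambda>\<pi>. \<Oplus>b\<in>{1..n}. ?h d b \<pi>) = (\<Oplus>b\<in>{1..n}. alt_sum k (?h d b))"
        using closed d by (intro alt_sum_finsum) auto
      also have "comm_ideal r \<dots>"
      proof (intro comm_ideal_finsum finite_atLeastAtMost)
        fix b assume "b \<in> {1..n}"
        then show "comm_ideal r (alt_sum k (?h d b))"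
          using Suc.prems d good[OF d, of b] by (intro Suc.IH) auto
      qed
      finally show "comm_ideal r (alt_sum k (\<lambda>\<pi>. \<Oplus>b\<in>{1..n}. ?h d b \<pi>))" .
    qed
    finally show ?case .
  qed
  have entry: "capelli ?M k x y (a, c) = \<zero>" if "a \<in> {1..n}" "c \<in> {1..n}" for a c
  proof -
    \<comment> \<open>The empty word has value 1 and starts the expansion at
      \<open>j = k\<close>.\<close>
    have "capelli ?M k x y (a, c) = alt_sum k (\<lambda>\<pi>. ?mono \<pi> k (a, c) \<otimes> word_value [] \<pi> k)"
      unfolding capelli_def alt_sum_def using that mono_entry
      by (subst matrix_entry_finsum)
        (auto simp: finite_permutations mono_closed matrix_entry_sign intro!: finsum_cong')
    then show ?thesis
      using expand[of k a c "[]"] that by (intro nilpotent) auto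
  qed
  have "capelli ?M k x y \<in> carrier ?M"
    unfolding capelli_def using mono_closed by (intro M.finsum_closed) auto
  then have "capelli ?M k x y \<in> ?I \<rightarrow>\<^sub>E carrier R" and "\<zero>\<^bsub>?M\<^esub> \<in> ?I \<rightarrow>\<^sub>E carrier R"
    using M.zero_closed by (simp_all add: matrix_ring_def)
  then show "capelli ?M k x y = \<zero>\<^bsub>?M\<^esub>"
    by (rule PiE_ext) (use entry in \<open>auto simp: matrix_entry_zero\<close>)
qed

end

subsection \<open>Grassmann algebras\<close>

locale grassmann = cring R for R :: "('a, 'b) ring_scheme" (structure) +
  fixes m :: nat
begin

abbreviation "F \<equiv> free_algebra R m"
abbreviation "G \<equiv> grassmann_algebra R m"
abbreviation "J \<equiv> Idl\<^bsub>F\<^esub> (grassmann_relations R m)"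

sublocale F: ring F
  by (rule free_algebra_ring)

sublocale G: ring G
  by (rule grassmann_algebra_ring)

lemma ideal_J: "ideal J F"
  by (intro F.genideal_ideal grassmann_relations_closed)

sublocale proj: ring_hom_ring F G "(+>\<^bsub>F\<^esub>) J"
  unfolding grassmann_algebra_def by (rule ideal.rcos_ring_hom_ring[OF ideal_J])

section \<open>Monomials spanning the free algebra and its quotient\<close>

definition free_term :: "'a \<Rightarrow> nat list \<Rightarrow> nat list \<Rightarrow> 'a" where
  "free_term r w = (\<lambda>u. if u = w then r else \<zero>)"

lemma free_term_closed [simp]:
  "r \<in> carrier R \<Longrightarrow> set w \<subseteq> {1..m} \<Longrightarrow> free_term r w \<in> carrier F"
  by (auto simp: free_term_def free_algebra_def)

lemma free_term_mult:
  assumes "r \<in> carrier R" "s \<in> carrier R"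
  shows "free_term r u \<otimes>\<^bsub>F\<^esub> free_term s v = free_term (r \<otimes> s) (u @ v)"
proof
  fix w
  have "(free_term r u \<otimes>\<^bsub>F\<^esub> free_term s v) w =
      (\<Oplus>p\<in>{(u, v). u @ v = w}. if (u, v) = p then r \<otimes> s else \<zero>)"
    unfolding free_algebra_def free_term_def using assms by (auto intro!: finsum_cong')
  also have "\<dots> = free_term (r \<otimes> s) (u @ v) w"
  proof (cases "u @ v = w")
    case True
    then show ?thesis
      using assms finsum_singleton[of "(u, v)" "{(u, v). u @ v = w}" "\<lambda>_. r \<otimes> s"]
      by (simp add: free_term_def finite_append_splits)
  next
    case False
    then show ?thesis
      by (subst add.finprod_one_eqI) (auto simp: free_term_def)
  qed
  finally show "(free_term r u \<otimes>\<^bsub>F\<^esub> free_term s v) w = free_term (r \<otimes> s) (u @ v) w" .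
qed

lemma free_term_add:
  "r \<in> carrier R \<Longrightarrow> s \<in> carrier R \<Longrightarrow>
    free_term r w \<oplus>\<^bsub>F\<^esub> free_term s w = free_term (r \<oplus> s) w"
  by (auto simp: free_term_def free_algebra_def)

lemma free_var_eq_free_term: "free_var R i = free_term \<one> [i]"
  by (simp add: free_var_def free_term_def)

text \<open>Induction on the size of the support: clearing one coefficient splits off a
  monomial.\<close>

lemma free_algebra_induct [consumes 1, case_names zero add mono]:
  assumes "f \<in> carrier F"
    and zero: "P \<zero>\<^bsub>F\<^esub>"
    and add: "\<And>f g. f \<in> carrier F \<Longrightarrow> g \<in> carrier F \<Longrightarrow> P f \<Longrightarrow> P g \<Longrightarrow> P (f \<oplus>\<^bsub>F\<^esub> g)"
    and mono: "\<And>r w. r \<in> carrier R \<Longrightarrow> set w \<subseteq> {1..m} \<Longrightarrow> P (free_term r w)"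
  shows "P f"
  using assms(1)
proof (induction "card {w. f w \<noteq> \<zero>}" arbitrary: f)
  case 0
  then have "f = \<zero>\<^bsub>F\<^esub>"
    by (auto simp: free_algebra_def fun_eq_iff)
  then show ?case
    using zero by simp
next
  case (Suc c)
  have f: "f w \<in> carrier R" "finite {w. f w \<noteq> \<zero>}" "f w \<noteq> \<zero> \<Longrightarrow> set w \<subseteq> {1..m}" for w
    using Suc.prems by (auto simp: free_algebra_def)
  obtain w where w: "f w \<noteq> \<zero>"
    using Suc.hyps(2) by (metis (mono_tags, lifting) card.empty empty_Collect_eq nat.distinct(1))
  define g where "g = f(w := \<zero>)"
  have supp: "{u. g u \<noteq> \<zero>} = {u. f u \<noteq> \<zero>} - {w}"
    by (auto simp: g_def)
  have "finite {u. g u \<noteq> \<zero>}"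
    unfolding supp using f(2) by simp
  then have g: "g \<in> carrier F"
    using f(1,3) by (auto simp: free_algebra_def g_def)
  have "f = free_term (f w) w \<oplus>\<^bsub>F\<^esub> g"
    using f by (auto simp: free_algebra_def free_term_def g_def)
  moreover have "P g"
    using g Suc.hyps(2) w f(2) by (intro Suc.hyps(1)) (simp_all add: supp card_Diff_singleton)
  moreover have "P (free_term (f w) w)" "free_term (f w) w \<in> carrier F"
    using mono[OF f(1) f(3)[OF w]] free_term_closed[OF f(1) f(3)[OF w]] by auto
  ultimately show ?case
    using add g by metis
qed

text \<open>The image of a monomial in the quotient. Its word may repeat letters and is in no
  particular order: these elements span \<open>G\<close>, and spanning suffices.\<close>

definition gterm :: "'a \<Rightarrow> nat list \<Rightarrow> (nat list \<Rightarrow> 'a) set" where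
  "gterm r w = J +>\<^bsub>F\<^esub> free_term r w"

lemma gterm_closed [simp]: "r \<in> carrier R \<Longrightarrow> set w \<subseteq> {1..m} \<Longrightarrow> gterm r w \<in> carrier G"
  by (simp add: gterm_def)

lemma gterm_mult:
  "\<lbrakk>r \<in> carrier R; s \<in> carrier R; set u \<subseteq> {1..m}; set v \<subseteq> {1..m}\<rbrakk> \<Longrightarrow>
    gterm r u \<otimes>\<^bsub>G\<^esub> gterm s v = gterm (r \<otimes> s) (u @ v)"
  by (simp add: gterm_def free_term_mult[symmetric])

lemma gterm_add:
  "\<lbrakk>r \<in> carrier R; s \<in> carrier R; set w \<subseteq> {1..m}\<rbrakk> \<Longrightarrow>
    gterm r w \<oplus>\<^bsub>G\<^esub> gterm s w = gterm (r \<oplus> s) w"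
  by (simp add: gterm_def free_term_add[symmetric])

lemma gterm_zero: "set w \<subseteq> {1..m} \<Longrightarrow> gterm \<zero> w = \<zero>\<^bsub>G\<^esub>"
  using gterm_add[of \<zero> \<zero> w] G.add.l_cancel_one'[of "gterm \<zero> w" "gterm \<zero> w"] by simp

lemma gterm_minus:
  "r \<in> carrier R \<Longrightarrow> set w \<subseteq> {1..m} \<Longrightarrow> \<ominus>\<^bsub>G\<^esub> gterm r w = gterm (\<ominus> r) w"
  by (rule G.minus_equality) (simp_all add: gterm_add gterm_zero l_neg)

lemma grassmann_induct [consumes 1, case_names zero add mono]:
  assumes "q \<in> carrier G"
    and zero: "P \<zero>\<^bsub>G\<^esub>"
    and add: "\<And>a b. a \<in> carrier G \<Longrightarrow> b \<in> carrier G \<Longrightarrow> P a \<Longrightarrow> P b \<Longrightarrow> P (a \<oplus>\<^bsub>G\<^esub> b)"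
    and mono: "\<And>r w. r \<in> carrier R \<Longrightarrow> set w \<subseteq> {1..m} \<Longrightarrow> P (gterm r w)"
  shows "P q"
proof -
  have "q \<in> a_rcosets\<^bsub>F\<^esub> J"
    using assms(1) unfolding grassmann_algebra_def FactRing_def by (simp only: partial_object.simps)
  then obtain f where f: "f \<in> carrier F" "q = J +>\<^bsub>F\<^esub> f"
    unfolding A_RCOSETS_def' by blast
  from f(1) have "P (J +>\<^bsub>F\<^esub> f)"
    by (induction rule: free_algebra_induct) (use zero add mono in \<open>auto simp: gterm_def\<close>)
  then show ?thesis
    using f(2) by simp
qed

section \<open>Relations between monomials in the Grassmann algebra\<close>

lemma proj_relation:
  assumes "f \<in> grassmann_relations R m"
  shows "J +>\<^bsub>F\<^esub> f = \<zero>\<^bsub>G\<^esub>"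
proof -
  have "f \<in> J"
    using F.genideal_self[OF grassmann_relations_closed] assms by blast
  then have "J +>\<^bsub>F\<^esub> f = J"
    by (intro F.a_rcos_zero[OF ideal_J])
  then show ?thesis
    unfolding grassmann_algebra_def FactRing_def by (simp only: ring.simps)
qed

lemma gterm_square: "i \<in> {1..m} \<Longrightarrow> gterm \<one> [i, i] = \<zero>\<^bsub>G\<^esub>"
  using proj_relation[of "free_var R i \<otimes>\<^bsub>F\<^esub> free_var R i"]
  by (auto simp: grassmann_relations_def Let_def free_var_eq_free_term free_term_mult gterm_def)

lemma gterm_less_anticommute:
  assumes "1 \<le> i" "i < j" "j \<le> m"
  shows "gterm \<one> [i, j] \<oplus>\<^bsub>G\<^esub> gterm \<one> [j, i] = \<zero>\<^bsub>G\<^esub>"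
proof -
  let ?f = "(free_var R i \<otimes>\<^bsub>F\<^esub> free_var R j) \<oplus>\<^bsub>F\<^esub> (free_var R j \<otimes>\<^bsub>F\<^esub> free_var R i)"
  have "?f \<in> grassmann_relations R m"
    using assms unfolding grassmann_relations_def Let_def by blast
  then have "J +>\<^bsub>F\<^esub> ?f = \<zero>\<^bsub>G\<^esub>"
    by (rule proj_relation)
  then show ?thesis
    using assms by (simp add: free_var_eq_free_term free_term_mult gterm_def)
qed

text \<open>The relations give this for distinct letters; for equal letters both sides
  vanish.\<close>

lemma gterm_anticommute:
  assumes "i \<in> {1..m}" "j \<in> {1..m}"
  shows "gterm \<one> [i, j] = \<ominus>\<^bsub>G\<^esub> gterm \<one> [j, i]"
proof (cases i j rule: linorder_cases)
  case less
  then show ?thesis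
    using assms gterm_less_anticommute[of i j] by (intro G.minus_equality[symmetric]) auto
next
  case equal
  then show ?thesis
    using assms by (simp add: gterm_square)
next
  case greater
  then show ?thesis
    using assms gterm_less_anticommute[of j i]
    by (intro G.minus_equality[symmetric]) (auto simp: G.a_comm)
qed

text \<open>Isolates a factor inside a word so that a relation can be applied to it.\<close>

lemma gterm_infix:
  assumes "r \<in> carrier R" "set u \<subseteq> {1..m}" "set w \<subseteq> {1..m}" "set v \<subseteq> {1..m}"
  shows "gterm r (u @ w @ v) = gterm r u \<otimes>\<^bsub>G\<^esub> gterm \<one> w \<otimes>\<^bsub>G\<^esub> gterm \<one> v"
  using assms by (simp add: gterm_mult)

lemma gterm_swap:
  assumes "r \<in> carrier R" "set u \<subseteq> {1..m}" "i \<in> {1..m}" "j \<in> {1..m}" "set v \<subseteq> {1..m}"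
  shows "gterm r (u @ i # j # v) = \<ominus>\<^bsub>G\<^esub> gterm r (u @ j # i # v)"
  using assms gterm_infix[of r u "[i, j]" v] gterm_infix[of r u "[j, i]" v] gterm_anticommute[of i j]
  by (simp add: G.r_minus G.l_minus)

lemma gterm_adjacent:
  assumes "r \<in> carrier R" "set u \<subseteq> {1..m}" "i \<in> {1..m}" "set v \<subseteq> {1..m}"
  shows "gterm r (u @ i # i # v) = \<zero>\<^bsub>G\<^esub>"
  using assms gterm_infix[of r u "[i, i]" v] gterm_square[of i] by simp

definition parity :: "nat \<Rightarrow> (nat list \<Rightarrow> 'a) set \<Rightarrow> (nat list \<Rightarrow> 'a) set" where
  "parity n a = (if even n then a else \<ominus>\<^bsub>G\<^esub> a)"

lemma gterm_move_letter:
  assumes "r \<in> carrier R" "i \<in> {1..m}" "set v \<subseteq> {1..m}"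
  shows "set u \<subseteq> {1..m} \<Longrightarrow> set w \<subseteq> {1..m} \<Longrightarrow>
    gterm r (u @ i # w @ v) = parity (length w) (gterm r (u @ w @ i # v))"
proof (induction w arbitrary: u)
  case (Cons j w)
  have "gterm r (u @ i # (j # w) @ v) = \<ominus>\<^bsub>G\<^esub> gterm r ((u @ [j]) @ i # w @ v)"
    using assms Cons.prems gterm_swap[of r u i j "w @ v"] by simp
  also have "\<dots> = \<ominus>\<^bsub>G\<^esub> parity (length w) (gterm r (u @ (j # w) @ i # v))"
    using Cons.IH[of "u @ [j]"] Cons.prems by simp
  finally show ?case
    using assms Cons.prems by (simp add: parity_def)
qed (simp add: parity_def)

text \<open>Each letter of \<open>v\<close> passes all of \<open>w\<close>, at the cost of one sign
  per letter passed.\<close>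

lemma gterm_swap_words:
  assumes "r \<in> carrier R" "set w \<subseteq> {1..m}"
  shows "set u \<subseteq> {1..m} \<Longrightarrow> set v \<subseteq> {1..m} \<Longrightarrow>
    gterm r (u @ v @ w) = parity (length v * length w) (gterm r (u @ w @ v))"
proof (induction v arbitrary: u)
  case (Cons i v)
  have "gterm r (u @ (i # v) @ w) = parity (length v * length w) (gterm r (u @ i # w @ v))"
    using Cons.IH[of "u @ [i]"] Cons.prems by simp
  also have "gterm r (u @ i # w @ v) = parity (length w) (gterm r (u @ w @ i # v))"
    using assms Cons.prems by (intro gterm_move_letter) auto
  finally show ?case
    using assms Cons.prems by (simp add: parity_def)
qed (simp add: parity_def)

text \<open>Up to sign, two equal letters can be brought next to each other, where their square is
  zero.\<close>

lemma gterm_not_distinct: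
  assumes "r \<in> carrier R" "set w \<subseteq> {1..m}" "\<not> distinct w"
  shows "gterm r w = \<zero>\<^bsub>G\<^esub>"
proof -
  obtain u i v v' where w: "w = u @ [i] @ v @ [i] @ v'"
    using not_distinct_decomp[OF assms(3)] by blast
  then have "gterm r w = parity (length v) (gterm r (u @ v @ i # i # v'))"
    using gterm_move_letter[of r i "i # v'" u v] assms by simp
  moreover have "gterm r (u @ v @ i # i # v') = \<zero>\<^bsub>G\<^esub>"
    using gterm_adjacent[of r "u @ v" i v'] assms w by simp
  ultimately show ?thesis
    by (simp add: parity_def)
qed

text \<open>The degree filtration. Unlike a grading, it does not require degrees to be well defined
  in the quotient.\<close>

inductive filtered :: "nat \<Rightarrow> (nat list \<Rightarrow> 'a) set \<Rightarrow> bool" where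
  zero: "filtered d \<zero>\<^bsub>G\<^esub>"
| add: "filtered d a \<Longrightarrow> filtered d b \<Longrightarrow> filtered d (a \<oplus>\<^bsub>G\<^esub> b)"
| gterm: "r \<in> carrier R \<Longrightarrow> set w \<subseteq> {1..m} \<Longrightarrow> d \<le> length w \<Longrightarrow> filtered d (gterm r w)"

lemma filtered_closed: "filtered d a \<Longrightarrow> a \<in> carrier G"
  by (induction rule: filtered.induct) auto

lemma filtered_0: "a \<in> carrier G \<Longrightarrow> filtered 0 a"
  by (induction rule: grassmann_induct) (rule filtered.intros; simp)+

lemma filtered_minus: "filtered d a \<Longrightarrow> filtered d (\<ominus>\<^bsub>G\<^esub> a)"
proof (induction rule: filtered.induct)
  case (add d a b)
  then show ?case
    using G.minus_add[of a b] by (simp add: filtered.add filtered_closed)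
next
  case (gterm r w d)
  then show ?case
    by (simp only: gterm_minus) (rule filtered.gterm; simp)
qed (simp add: filtered.zero)

lemma filtered_mult:
  assumes "filtered d a" "filtered e b"
  shows "filtered (d + e) (a \<otimes>\<^bsub>G\<^esub> b)"
  using assms(1)
proof (induction rule: filtered.induct)
  case (add d a a')
  then show ?case
    using assms(2) by (simp add: filtered_closed G.l_distr filtered.add)
next
  case (gterm r w d)
  from assms(2) show ?case
  proof (induction rule: filtered.induct)
    case (add e b b')
    then show ?case
      using gterm by (simp add: filtered_closed G.r_distr filtered.add)
  next
    case (gterm s v e)
    then show ?case
      using \<open>r \<in> carrier R\<close> \<open>set w \<subseteq> {1..m}\<close> \<open>d \<le> length w\<close>
      by (simp only: gterm_mult) (rule filtered.gterm; simp)
  qed (use gterm in \<open>auto intro: filtered.zero\<close>)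
qed (use assms(2) in \<open>auto simp: filtered_closed intro: filtered.zero\<close>)

text \<open>A word with more than \<open>m\<close> letters repeats one of them.\<close>

lemma filtered_eq_zero: "filtered d a \<Longrightarrow> m < d \<Longrightarrow> a = \<zero>\<^bsub>G\<^esub>"
proof (induction rule: filtered.induct)
  case (gterm r w d)
  then have "card (set w) < length w"
    using card_mono[of "{1..m}" "set w"] by simp
  then show ?case
    using gterm by (intro gterm_not_distinct) (auto simp: distinct_card)
qed auto

section \<open>Commutators in the Grassmann algebra\<close>

lemma commutator_add_left:
  "\<lbrakk>a \<in> carrier G; b \<in> carrier G; c \<in> carrier G\<rbrakk> \<Longrightarrow>
    G.commutator (a \<oplus>\<^bsub>G\<^esub> b) c = G.commutator a c \<oplus>\<^bsub>G\<^esub> G.commutator b c"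
  unfolding G.commutator_def by (simp add: G.l_distr G.r_distr G.minus_eq G.minus_add G.a_ac)

lemma commutator_add_right:
  "\<lbrakk>a \<in> carrier G; b \<in> carrier G; c \<in> carrier G\<rbrakk> \<Longrightarrow>
    G.commutator c (a \<oplus>\<^bsub>G\<^esub> b) = G.commutator c a \<oplus>\<^bsub>G\<^esub> G.commutator c b"
  unfolding G.commutator_def by (simp add: G.l_distr G.r_distr G.minus_eq G.minus_add G.a_ac)

text \<open>Swapping the words costs (-1) to the product of their lengths, so uv - vu is either 0 or
  2uv; the coefficient is 2rs written as a sum.\<close>

lemma commutator_gterm:
  assumes "r \<in> carrier R" "s \<in> carrier R" "set u \<subseteq> {1..m}" "set v \<subseteq> {1..m}"
  shows "G.commutator (gterm r u) (gterm s v) =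
    (if even (length u * length v) then \<zero>\<^bsub>G\<^esub> else gterm (r \<otimes> s \<oplus> r \<otimes> s) (u @ v))"
proof -
  have "gterm (s \<otimes> r) (v @ u) = parity (length v * length u) (gterm (r \<otimes> s) (u @ v))"
    using assms gterm_swap_words[of "s \<otimes> r" u "[]" v] by (simp add: m_comm)
  then show ?thesis
    using assms unfolding G.commutator_def
    by (simp add: gterm_mult parity_def mult.commute G.minus_eq G.r_neg gterm_add)
qed

text \<open>By biadditivity only monomials matter, and these have a nonzero commutator only for two
  words of odd length, whose concatenation is even with at least two letters. Evenness yields
  centrality, the length yields the degree estimate.\<close>

lemma commutator_induct [consumes 2, case_names zero add mono]:
  assumes "a \<in> carrier G" "b \<in> carrier G"
    and zero: "P \<zero>\<^bsub>G\<^esub>"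
    and add: "\<And>a b. a \<in> carrier G \<Longrightarrow> b \<in> carrier G \<Longrightarrow> P a \<Longrightarrow> P b \<Longrightarrow> P (a \<oplus>\<^bsub>G\<^esub> b)"
    and mono: "\<And>r w. \<lbrakk>r \<in> carrier R; set w \<subseteq> {1..m}; even (length w); 2 \<le> length w\<rbrakk> \<Longrightarrow>
      P (gterm r w)"
  shows "P (G.commutator a b)"
  using assms(1)
proof (induction rule: grassmann_induct)
  case zero
  then show ?case
    using assms(2) \<open>P \<zero>\<^bsub>G\<^esub>\<close> by (simp add: G.commutator_def G.minus_eq)
next
  case (add a a')
  then show ?case
    using assms(2,4) by (simp add: commutator_add_left)
next
  case (mono r u)
  from assms(2) show ?case
  proof (induction rule: grassmann_induct)
    case zero
    then show ?case
      using \<open>r \<in> carrier R\<close> \<open>set u \<subseteq> {1..m}\<close> \<open>P \<zero>\<^bsub>G\<^esub>\<close> by (simp add: G.commutator_def G.minus_eq)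
  next
    case (add b b')
    then show ?case
      using \<open>r \<in> carrier R\<close> \<open>set u \<subseteq> {1..m}\<close> assms(4) by (simp add: commutator_add_right)
  next
    case (mono s v)
    have "even (length u + length v) \<and> 2 \<le> length u + length v" if "odd (length u * length v)"
    proof -
      have "odd (length u)" "odd (length v)"
        using that by auto
      then show ?thesis
        by (cases u; cases v) auto
    qed
    then show ?case
      using mono \<open>r \<in> carrier R\<close> \<open>set u \<subseteq> {1..m}\<close> assms(3)
        assms(5)[of "r \<otimes> s \<oplus> r \<otimes> s" "u @ v"]
      by (simp add: commutator_gterm)
  qed
qed

text \<open>A word of even length passes any other word without a sign.\<close>

lemma grassmann_commutator_central:
  assumes "a \<in> carrier G" "b \<in> carrier G" "c \<in> carrier G"
  shows "G.commutator a b \<otimes>\<^bsub>G\<^esub> c = c \<otimes>\<^bsub>G\<^esub> G.commutator a b"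
  using assms(1,2)
proof (induction rule: commutator_induct)
  case (add a b)
  then show ?case
    using assms(3) by (simp add: G.l_distr G.r_distr)
next
  case (mono r w)
  from assms(3) show ?case
  proof (induction rule: grassmann_induct)
    case (mono s v)
    then show ?case
      using \<open>r \<in> carrier R\<close> \<open>set w \<subseteq> {1..m}\<close> \<open>even (length w)\<close> gterm_swap_words[of "r \<otimes> s" v "[]" w]
      by (simp add: gterm_mult parity_def m_comm)
  qed (use mono in \<open>auto simp: G.l_distr G.r_distr\<close>)
qed (use assms(3) in auto)

sublocale G: central_commutators G
  by unfold_locales (rule grassmann_commutator_central)

lemma filtered_commutator:
  "a \<in> carrier G \<Longrightarrow> b \<in> carrier G \<Longrightarrow> filtered 2 (G.commutator a b)"
  by (induction rule: commutator_induct) (rule filtered.intros; simp)+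

text \<open>Every commutator factor raises the degree by at least two.\<close>

lemma comm_ideal_filtered: "G.comm_ideal r a \<Longrightarrow> filtered (2 * r) a"
proof (induction rule: G.comm_ideal.induct)
  case (mult a b r e)
  then show ?case
    using filtered_mult[OF filtered_commutator, of a b "2 * r" e] by simp
qed (simp_all add: filtered_0 filtered.zero filtered.add filtered_minus)

end

theorem theorem5:
  fixes R :: "('a, 'b) ring_scheme" and m n :: nat
  assumes "cring R" and "n \<ge> 1"
  shows "satisfies_capelli (matrix_ring n (grassmann_algebra R m)) (n^2 + 2 * (m div 2) + 1)"
proof -
  interpret cring R
    by fact
  interpret grassmann R m ..
  show ?thesis
  proof (rule G.matrix_ring_satisfies_capelli)
    \<comment> \<open>With \<open>r = Suc (m div 2)\<close> the degree \<open>2 * r\<close> exceeds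
      \<open>m\<close>, and \<open>n^2 + 2 * r\<close> is one more than the required
      x-degree.\<close>
    fix a assume "G.comm_ideal (Suc (m div 2)) a"
    then show "a = \<zero>\<^bsub>G\<^esub>"
      by (rule filtered_eq_zero[OF comm_ideal_filtered]) simp
  qed simp
qed

end
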